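(* Let $\mathfrak B$ be a reduct of a countable finitely homogeneous Ramsey structure $\mathfrak A$ and let $\mathscr E$ be a clone. Suppose that $\zeta\colon\operatorname{Pol}(\mathfrak B)\cap\operatorname{Can}(\mathfrak A)\to\mathscr E$ is minor-preserving and has the unique interpolation property (UIP) with respect to $\operatorname{Pol}(\mathfrak B)$ over $\mathfrak A$. Then $\zeta$ can be extended to a uniformly continuous minor-preserving map $\tilde\zeta\colon\operatorname{Pol}(\mathfrak B)\to\mathscr E$.
   Context: All structures are relational. A structure is homogeneous if every isomorphism between finite substructures extends to an automorphism; finitely homogeneous means homogeneous with a finite relational signature. For structures $\mathfrak A,\mathfrak B$ in the same signature, $\binom{\mathfrak B}{\mathfrak A}$ is the set of embeddings of $\mathfrak A$ into $\mathfrak B$; $\mathfrak C\to(\mathfrak B)^{\mathfrak A}_r$ means that for every $\chi\colon\binom{\mathfrak C}{\mathfrak A}\to\{1,\dots,r\}$ there is $e\in\binom{\mathfrak C}{\mathfrak B}$ such that $\chi$ is constant on $\{e\circ f: f\in\binom{\mathfrak B}{\mathfrak A}\}$. A homogeneous structure is Ramsey if its age $\mathcal K$ (the class of finite structures embedding into it) satisfies: for all $\mathfrak A,\mathfrak B\in\mathcal K$, $r\in\mathbb N$ there is $\mathfrak C\in\mathcal K$ with $\mathfrak C\to(\mathfrak B)^{\mathfrak A}_r$. $\operatorname{Pol}(\mathfrak B)$ is the clone of all homomorphisms from finite direct powers $\mathfrak B^k$ to $\mathfrak B$. $\operatorname{typ}^{\mathfrak A}(a)$ is the set of first-order formulas satisfied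 by the tuple $a$ in $\mathfrak A$. An operation $f\colon A^k\to A$ is canonical over $\mathfrak A$ if for all $n$ and $a_1,\dots,a_k,b_1,\dots,b_k\in A^n$ with $\operatorname{typ}^{\mathfrak A}(a_i)=\operatorname{typ}^{\mathfrak A}(b_i)$ for all $i$ we have $\operatorname{typ}^{\mathfrak A}(f(a_1,\dots,a_k))=\operatorname{typ}^{\mathfrak A}(f(b_1,\dots,b_k))$ (componentwise application). $\operatorname{Can}(\mathfrak A)$ is the clone of these operations. For a set $\mathscr M$ of maps $A\to A$, $f\colon A^k\to A$ interpolates $g\colon A^k\to A$ over $\mathscr M$ if for every finite $F\subseteq A$ there are $u,v_1,\dots,v_k\in\mathscr M$ with $g(a_1,\dots,a_k)=u(f(v_1(a_1),\dots,v_k(a_k)))$ for all $a_1,\dots,a_k\in F$. For a clone $\mathscr C$ containing $\operatorname{Aut}(\mathfrak A)$, a function $\zeta$ defined on $\mathscr D\subseteq\mathscr C$ has the UIP with respect to $\mathscr C$ over $\mathfrak A$ if $\zeta(g)=\zeta(h)$ for all $g,h\in\mathscr D$ that are interpolated by the same operation $f\in\mathscr C$ over $\operatorname{Aut}(\mathfrak A)$. For $f$ of arity $n$ and $\alpha\colon\{1,\dots,n\}\to\{1,\dots,k\}$ let $f_\alpha(x_1,\dots,x_k)=f(x_{\alpha(1)},\dots,x_{\alpha(n)})$. An arity-preserving map $\zeta$ between clones is minor-preserving if $\zeta(f_\alpha)=\zeta(f)_\alpha$ for all such $f,\alpha$. A map $\zeta\colon\mathscr C_1\to\mathscr C_2$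 between clones on sets $A_1$ and $A_2$ is uniformly continuous if for every finite $G\subseteq A_2$ there is a finite $F\subseteq A_1$ such that for all $n$ and all $n$-ary $f,g\in\mathscr C_1$, $f|_{F^n}=g|_{F^n}$ implies $\zeta(f)|_{G^n}=\zeta(g)|_{G^n}$. *)

theory Defs
  imports "HOL-Library.FuncSet" "HOL-Library.Countable_Set"
begin

section \<open>Relational structures\<close>

text \<open>A signature is a partial map from relation symbols to arities. Values of \<open>intp\<close> at symbols
  outside the signature are irrelevant. Maps between structures are extensional functions
  on the domain, so that equality of maps is equality of functions.\<close>

definition tuples :: "'a set \<Rightarrow> nat \<Rightarrow> 'a list set" where
  "tuples X n = {xs. set xs \<subseteq> X \<and> length xs = n}"

record ('s, 'a) struct =
  univ :: "'a set"
  sig :: "'s \<Rightarrow> nat option"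
  intp :: "'s \<Rightarrow> 'a list set"

definition is_structure :: "('s, 'a) struct \<Rightarrow> bool" where
  "is_structure A \<longleftrightarrow> (\<forall>s n. sig A s = Some n \<longrightarrow> intp A s \<subseteq> tuples (univ A) n)"

definition homomorphisms :: "('s, 'a) struct \<Rightarrow> ('s, 'b) struct \<Rightarrow> ('a \<Rightarrow> 'b) set" where
  "homomorphisms A B = {f \<in> univ A \<rightarrow>\<^sub>E univ B.
     \<forall>s\<in>dom (sig A). \<forall>xs\<in>intp A s. map f xs \<in> intp B s}"

definition embeddings :: "('s, 'a) struct \<Rightarrow> ('s, 'b) struct \<Rightarrow> ('a \<Rightarrow> 'b) set" where
  "embeddings A B = {f \<in> univ A \<rightarrow>\<^sub>E univ B. inj_on f (univ A) \<and>
     (\<forall>s n. sig A s = Some n \<longrightarrow>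
        (\<forall>xs\<in>tuples (univ A) n. xs \<in> intp A s \<longleftrightarrow> map f xs \<in> intp B s))}"

definition isomorphisms :: "('s, 'a) struct \<Rightarrow> ('s, 'b) struct \<Rightarrow> ('a \<Rightarrow> 'b) set" where
  "isomorphisms A B = {f \<in> embeddings A B. f ` univ A = univ B}"

definition Aut :: "('s, 'a) struct \<Rightarrow> ('a \<Rightarrow> 'a) set" where
  "Aut A = isomorphisms A A"

definition substructure_on :: "('s, 'a) struct \<Rightarrow> 'a set \<Rightarrow> ('s, 'a) struct" where
  "substructure_on A S = \<lparr>univ = S, sig = sig A, intp = (\<lambda>s. intp A s \<inter> lists S)\<rparr>"

definition power_structure :: "('s, 'a) struct \<Rightarrow> nat \<Rightarrow> ('s, 'a list) struct" where
  "power_structure A k = \<lparr>univ = tuples (univ A) k, sig = sig A,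
     intp = (\<lambda>s. {ts \<in> tuples (tuples (univ A) k) (the (sig A s)).
                    \<forall>i<k. map (\<lambda>t. t ! i) ts \<in> intp A s})\<rparr>"

definition homogeneous :: "('s, 'a) struct \<Rightarrow> bool" where
  "homogeneous A \<longleftrightarrow>
     (\<forall>S T f. finite S \<and> S \<subseteq> univ A \<and> finite T \<and> T \<subseteq> univ A \<and>
        f \<in> isomorphisms (substructure_on A S) (substructure_on A T) \<longrightarrow>
        (\<exists>g\<in>Aut A. \<forall>x\<in>S. g x = f x))"

definition finitely_homogeneous :: "('s, 'a) struct \<Rightarrow> bool" where
  "finitely_homogeneous A \<longleftrightarrow> homogeneous A \<and> finite (dom (sig A))"

section \<open>The Ramsey property\<close>

text \<open>Every finite structure has an isomorphic copy whose domain is a set of natural numbers,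
  so the age is represented by its members of this form.\<close>

definition age :: "('s, 'a) struct \<Rightarrow> ('s, nat) struct set" where
  "age A = {K. is_structure K \<and> finite (univ K) \<and> sig K = sig A \<and> embeddings K A \<noteq> {}}"

definition partition_arrow ::
  "('s, 'c) struct \<Rightarrow> ('s, 'b) struct \<Rightarrow> ('s, 'a) struct \<Rightarrow> nat \<Rightarrow> bool" where
  "partition_arrow C B A r \<longleftrightarrow>
     (\<forall>\<chi> \<in> embeddings A C \<rightarrow> {1..r}.
        \<exists>e\<in>embeddings B C. \<exists>c. \<forall>f\<in>embeddings A B. \<chi> (compose (univ A) e f) = c)"

definition ramsey :: "('s, 'a) struct \<Rightarrow> bool" where
  "ramsey S \<longleftrightarrow> (\<forall>A\<in>age S. \<forall>B\<in>age S. \<forall>r. \<exists>C\<in>age S. partition_arrow C B A r)"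

section \<open>First-order formulas, types and reducts\<close>

datatype 's fo_formula =
    Eq nat nat
  | Rel 's "nat list"
  | Neg "'s fo_formula"
  | Conj "'s fo_formula" "'s fo_formula"
  | Ex nat "'s fo_formula"

fun free_vars :: "'s fo_formula \<Rightarrow> nat set" where
  "free_vars (Eq x y) = {x, y}"
| "free_vars (Rel s xs) = set xs"
| "free_vars (Neg \<phi>) = free_vars \<phi>"
| "free_vars (Conj \<phi> \<psi>) = free_vars \<phi> \<union> free_vars \<psi>"
| "free_vars (Ex x \<phi>) = free_vars \<phi> - {x}"

fun formula_over :: "('s \<Rightarrow> nat option) \<Rightarrow> 's fo_formula \<Rightarrow> bool" where
  "formula_over \<sigma> (Eq x y) = True"
| "formula_over \<sigma> (Rel s xs) = (\<sigma> s = Some (length xs))"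
| "formula_over \<sigma> (Neg \<phi>) = formula_over \<sigma> \<phi>"
| "formula_over \<sigma> (Conj \<phi> \<psi>) = (formula_over \<sigma> \<phi> \<and> formula_over \<sigma> \<psi>)"
| "formula_over \<sigma> (Ex x \<phi>) = formula_over \<sigma> \<phi>"

fun sat :: "('s, 'a) struct \<Rightarrow> (nat \<Rightarrow> 'a) \<Rightarrow> 's fo_formula \<Rightarrow> bool" where
  "sat A v (Eq x y) = (v x = v y)"
| "sat A v (Rel s xs) = (map v xs \<in> intp A s)"
| "sat A v (Neg \<phi>) = (\<not> sat A v \<phi>)"
| "sat A v (Conj \<phi> \<psi>) = (sat A v \<phi> \<and> sat A v \<psi>)"
| "sat A v (Ex x \<phi>) = (\<exists>d\<in>univ A. sat A (v(x := d)) \<phi>)"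

definition formulas :: "('s \<Rightarrow> nat option) \<Rightarrow> nat \<Rightarrow> 's fo_formula set" where
  "formulas \<sigma> n = {\<phi>. formula_over \<sigma> \<phi> \<and> free_vars \<phi> \<subseteq> {..<n}}"

definition fo_type :: "('s, 'a) struct \<Rightarrow> 'a list \<Rightarrow> 's fo_formula set" where
  "fo_type A a = {\<phi> \<in> formulas (sig A) (length a). sat A (\<lambda>i. a ! i) \<phi>}"

text \<open>Reducts are understood in the first-order sense: same domain, and every relation is
  first-order definable without parameters. Dropping relations is a special case. The signature
  of the reduct may be infinite.\<close>

definition reduct :: "('t, 'a) struct \<Rightarrow> ('s, 'a) struct \<Rightarrow> bool" where
  "reduct B A \<longleftrightarrow> is_structure B \<and> univ B = univ A \<and>
     (\<forall>s n. sig B s = Some n \<longrightarrow>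
        (\<exists>\<phi>\<in>formulas (sig A) n. intp B s = {xs \<in> tuples (univ A) n. \<phi> \<in> fo_type A xs}))"

section \<open>Operations and clones\<close>

text \<open>Operations have positive arity and act on lists of that length; outside of these lists
  they are \<open>undefined\<close>. The arity is stored since it cannot be recovered from the function
  when the domain is empty.\<close>

datatype 'a operation = Operation (arity: nat) (fn: "'a list \<Rightarrow> 'a")

definition operations :: "'a set \<Rightarrow> 'a operation set" where
  "operations X = {f. arity f \<ge> 1 \<and> fn f \<in> tuples X (arity f) \<rightarrow>\<^sub>E X}"

definition projection :: "'a set \<Rightarrow> nat \<Rightarrow> nat \<Rightarrow> 'a operation" where
  "projection X k i = Operation k (\<lambda>xs\<in>tuples X k. xs ! i)"

definition superpose :: "'a set \<Rightarrow> nat \<Rightarrow> 'a operation \<Rightarrow> 'a operation list \<Rightarrow> 'a operation" where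
  "superpose X k f gs = Operation k (\<lambda>xs\<in>tuples X k. fn f (map (\<lambda>g. fn g xs) gs))"

definition clone :: "'a set \<Rightarrow> 'a operation set \<Rightarrow> bool" where
  "clone X C \<longleftrightarrow> C \<subseteq> operations X \<and>
     (\<forall>k. \<forall>i<k. projection X k i \<in> C) \<and>
     (\<forall>k. \<forall>f\<in>C. \<forall>gs\<in>tuples {g \<in> C. arity g = k} (arity f). superpose X k f gs \<in> C)"

definition Pol :: "('s, 'a) struct \<Rightarrow> 'a operation set" where
  "Pol B = {f. arity f \<ge> 1 \<and> fn f \<in> homomorphisms (power_structure B (arity f)) B}"

text \<open>Componentwise application of an operation to a list of \<open>n\<close>-tuples.\<close>

definition apply_componentwise :: "'a operation \<Rightarrow> nat \<Rightarrow> 'a list list \<Rightarrow> 'a list" where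
  "apply_componentwise f n as = map (\<lambda>j. fn f (map (\<lambda>a. a ! j) as)) [0..<n]"

definition canonical :: "('s, 'a) struct \<Rightarrow> 'a operation \<Rightarrow> bool" where
  "canonical A f \<longleftrightarrow>
     (\<forall>n. \<forall>as\<in>tuples (tuples (univ A) n) (arity f). \<forall>bs\<in>tuples (tuples (univ A) n) (arity f).
        (\<forall>i<arity f. fo_type A (as ! i) = fo_type A (bs ! i)) \<longrightarrow>
        fo_type A (apply_componentwise f n as) = fo_type A (apply_componentwise f n bs))"

definition Can :: "('s, 'a) struct \<Rightarrow> 'a operation set" where
  "Can A = {f \<in> operations (univ A). canonical A f}"

section \<open>Interpolation and maps between clones\<close>

definition interpolates ::
  "'a set \<Rightarrow> ('a \<Rightarrow> 'a) set \<Rightarrow> 'a operation \<Rightarrow> 'a operation \<Rightarrow> bool" where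
  "interpolates X M f g \<longleftrightarrow> arity f = arity g \<and>
     (\<forall>F. finite F \<and> F \<subseteq> X \<longrightarrow>
        (\<exists>u\<in>M. \<exists>v\<in>{..<arity f} \<rightarrow> M. \<forall>xs\<in>tuples F (arity f).
           fn g xs = u (fn f (map (\<lambda>i. v i (xs ! i)) [0..<arity f]))))"

definition has_UIP ::
  "('s, 'a) struct \<Rightarrow> 'a operation set \<Rightarrow> 'a operation set \<Rightarrow> ('a operation \<Rightarrow> 'b) \<Rightarrow> bool" where
  "has_UIP A C D \<zeta> \<longleftrightarrow>
     (\<forall>g\<in>D. \<forall>h\<in>D. \<forall>f\<in>C.
        interpolates (univ A) (Aut A) f g \<and> interpolates (univ A) (Aut A) f h \<longrightarrow> \<zeta> g = \<zeta> h)"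

text \<open>Argument positions are numbered from \<open>0\<close>.\<close>

definition minor :: "'a set \<Rightarrow> nat \<Rightarrow> (nat \<Rightarrow> nat) \<Rightarrow> 'a operation \<Rightarrow> 'a operation" where
  "minor X k \<alpha> f =
     Operation k (\<lambda>xs\<in>tuples X k. fn f (map (\<lambda>i. xs ! \<alpha> i) [0..<arity f]))"

definition minor_preserving ::
  "'a set \<Rightarrow> 'a operation set \<Rightarrow> 'b set \<Rightarrow> 'b operation set \<Rightarrow> ('a operation \<Rightarrow> 'b operation) \<Rightarrow> bool"
where
  "minor_preserving X C Y D \<zeta> \<longleftrightarrow> \<zeta> \<in> C \<rightarrow> D \<and> (\<forall>f\<in>C. arity (\<zeta> f) = arity f) \<and>
     (\<forall>f\<in>C. \<forall>k. \<forall>\<alpha>\<in>{..<arity f} \<rightarrow> {..<k}. \<zeta> (minor X k \<alpha> f) = minor Y k \<alpha> (\<zeta> f))"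

definition clone_uniformly_continuous ::
  "'a set \<Rightarrow> 'a operation set \<Rightarrow> 'b set \<Rightarrow> ('a operation \<Rightarrow> 'b operation) \<Rightarrow> bool" where
  "clone_uniformly_continuous X C Y \<zeta> \<longleftrightarrow>
     (\<forall>G. finite G \<and> G \<subseteq> Y \<longrightarrow>
        (\<exists>F. finite F \<and> F \<subseteq> X \<and>
           (\<forall>n. \<forall>f\<in>C. \<forall>g\<in>C. arity f = n \<and> arity g = n \<and> (\<forall>xs\<in>tuples F n. fn f xs = fn g xs) \<longrightarrow>
              (\<forall>xs\<in>tuples G n. fn (\<zeta> f) xs = fn (\<zeta> g) xs))))"

end

theory Submission
  imports Defs
begin

text \<open>
  Let \<open>X\<close> be the domain of \<open>A\<close>. Homogeneity and the finite signature make the orbits of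
  \<open>Aut A\<close> on tuples the same thing as types, with finitely many orbits in each length. So canonicity is
  a statement about orbits, the polymorphisms of \<open>B\<close> are closed under composition with orbit
  preserving maps, and a compactness principle holds (\<open>limit_up_to_conjugation\<close>): every sequence of
  maps into \<open>X\<close> has a limit which, on every finite set, agrees with infinitely many of its terms up
  to automorphisms. From the Ramsey property of finite substructures one derives a product version
  (\<open>ramsey_product\<close>), and the two principles together yield the two constructions on which
  everything rests.

  \<^item> Every polymorphism of \<open>B\<close> interpolates a canonical one (\<open>canonization\<close>). Hence \<open>\<zeta>\<close> can be
    extended by sending \<open>f\<close> to \<open>\<zeta> g\<close> for any canonical \<open>g\<close> that \<open>f\<close> interpolates; the unique
    interpolation property makes this independent of \<open>g\<close>, and correct on canonical \<open>f\<close>, which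
    interpolates itself.
  \<^item> There are two orbit preserving self-maps \<open>\<rho>\<close> and \<open>\<sigma>\<close> of \<open>X\<close> that are independent: the orbit
    of the joint tuple consisting of \<open>\<rho> a\<close> and \<open>\<sigma> b\<close> is determined by the orbits of \<open>a\<close> and of \<open>b\<close>
    (\<open>independent_copies\<close>).

  Independence allows one to prescribe automorphisms separately on finite parts of the two copies
  \<open>\<rho> X\<close> and \<open>\<sigma> X\<close> of \<open>X\<close>. If \<open>f\<close> behaves like \<open>h\<close> after some maps that factor through \<open>\<rho>\<close> and like
  \<open>g\<close> after some other maps that factor through \<open>\<sigma>\<close>, then composing the arguments of \<open>f\<close> with such
  automorphisms and passing to a limit yields a single polymorphism that interpolates both \<open>h\<close> and
  \<open>g\<close> (\<open>common_interpolation\<close>), so that \<open>\<zeta> h = \<zeta> g\<close>.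

  Both remaining properties of the extension are instances of this. For minors, the difficulty is
  that \<open>f\<close> may be made canonical with different automorphisms for different arguments, whereas a
  minor of \<open>f\<close> must use the same automorphism for identified arguments; so the minor of the canonical
  operation for \<open>f\<close> need not be interpolated by the minor of \<open>f\<close>. A canonical
  operation \<open>h\<close> for the minor is obtained inside \<open>\<rho> X\<close>, a canonical operation \<open>g\<close> for \<open>f\<close> inside
  \<open>\<sigma> X\<close>, and one polymorphism interpolates both \<open>h\<close> and the minor of \<open>g\<close>. For uniform continuity,
  passing to minors reduces the claim to a fixed arity \<open>m\<close>. If it failed, there would be polymorphisms \<open>f l\<close> and
  \<open>g l\<close> that agree on larger and larger finite sets but have different images. Canonical operations
  of arity \<open>m\<close> have only finitely many behaviours, so the canonical operations for the \<open>f l\<close> inside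
  \<open>\<sigma> X\<close> can be assumed to behave alike, and similarly for the \<open>g l\<close>. The \<open>f l\<close> and the \<open>g l\<close>
  have a common limit, which has a canonical operation \<open>e\<close> inside \<open>\<rho> X\<close>; it is
  witnessed by finite parts of \<open>f l\<close> and \<open>g l\<close> alike, so both images are \<open>\<zeta> e\<close>.
\<close>

section \<open>Orbits of tuples\<close>

locale finitely_homogeneous_structure =
  fixes A :: "('s, 'a) struct"
  assumes is_structure: "is_structure A"
    and countable_univ: "countable (univ A)"
    and finitely_homogeneous: "finitely_homogeneous A"
begin

abbreviation X :: "'a set" where "X \<equiv> univ A"

lemma tuples_iff: "xs \<in> tuples S n \<longleftrightarrow> set xs \<subseteq> S \<and> length xs = n"
  by (simp add: tuples_def)

lemma Aut_iff:
  "g \<in> Aut A \<longleftrightarrow> g \<in> extensional X \<and> inj_on g X \<and> g ` X = X \<and>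
     (\<forall>s n. sig A s = Some n \<longrightarrow> (\<forall>xs\<in>tuples X n. xs \<in> intp A s \<longleftrightarrow> map g xs \<in> intp A s))"
  unfolding Aut_def isomorphisms_def embeddings_def PiE_def by auto

lemma Aut_closed: "g \<in> Aut A \<Longrightarrow> x \<in> X \<Longrightarrow> g x \<in> X"
  by (auto simp: Aut_iff)

lemma Aut_inj: "g \<in> Aut A \<Longrightarrow> inj_on g X"
  by (simp add: Aut_iff)

lemma Aut_intp:
  "g \<in> Aut A \<Longrightarrow> sig A s = Some (length xs) \<Longrightarrow> set xs \<subseteq> X \<Longrightarrow>
     map g xs \<in> intp A s \<longleftrightarrow> xs \<in> intp A s"
  unfolding Aut_iff by (auto simp: tuples_iff)

lemma Aut_id: "(\<lambda>x\<in>X. x) \<in> Aut A"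
proof -
  have "map (\<lambda>x\<in>X. x) xs = xs" if "set xs \<subseteq> X" for xs
    using that by (intro map_idI) auto
  then show ?thesis
    by (auto simp: Aut_iff tuples_iff inj_on_def)
qed

lemma Aut_compose:
  assumes "g \<in> Aut A" "h \<in> Aut A"
  shows "compose X g h \<in> Aut A"
proof -
  have 1: "compose X g h ` X = X"
    using assms by (simp add: Aut_iff compose_def image_image[symmetric])
  have 2: "inj_on (compose X g h) X"
    using assms by (intro inj_onI) (simp add: compose_def inj_on_eq_iff[OF Aut_inj] Aut_closed)
  have 3: "map (compose X g h) xs = map g (map h xs)" if "set xs \<subseteq> X" for xs
    using that by (auto simp: compose_def)
  have "map (compose X g h) xs \<in> intp A s \<longleftrightarrow> xs \<in> intp A s"
    if "sig A s = Some (length xs)" "set xs \<subseteq> X" for s xs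
  proof -
    have "set (map h xs) \<subseteq> X" using that assms(2) Aut_closed by auto
    then have "map g (map h xs) \<in> intp A s \<longleftrightarrow> map h xs \<in> intp A s"
      using Aut_intp[OF assms(1), of s "map h xs"] that by simp
    then show ?thesis unfolding 3[OF that(2)] using Aut_intp[OF assms(2)] that by simp
  qed
  with 1 2 show ?thesis by (auto simp: Aut_iff tuples_iff compose_def)
qed

lemma Aut_inverse:
  assumes "g \<in> Aut A"
  shows "\<exists>h\<in>Aut A. \<forall>x\<in>X. h (g x) = x \<and> g (h x) = x"
proof -
  define h where "h = (\<lambda>x\<in>X. inv_into X g x)"
  have inj: "inj_on g X" and im: "g ` X = X" using assms by (auto simp: Aut_iff)
  have gh: "g (h x) = x" and hX: "h x \<in> X" if "x \<in> X" for x
    using that im by (auto simp: h_def f_inv_into_f inv_into_into)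
  have hg: "h (g x) = x" if "x \<in> X" for x
    using that inj im by (auto simp: h_def)
  have "map h xs \<in> intp A s \<longleftrightarrow> xs \<in> intp A s"
    if "sig A s = Some (length xs)" "set xs \<subseteq> X" for s xs
  proof -
    have "map g (map h xs) = xs" using that gh by (auto intro!: map_idI)
    moreover have "set (map h xs) \<subseteq> X" using that hX by auto
    ultimately show ?thesis using Aut_intp[OF assms, of s "map h xs"] that by simp
  qed
  moreover have "h ` X = X"
  proof (intro equalityI subsetI)
    fix x assume x: "x \<in> X"
    then have "h (g x) = x" "g x \<in> X" using hg assms Aut_closed by auto
    then show "x \<in> h ` X" by (metis imageI)
  qed (use hX in auto)
  moreover have "inj_on h X" by (rule inj_on_inverseI[where g=g]) (rule gh)
  ultimately have "h \<in> Aut A"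
    by (auto simp: Aut_iff tuples_iff h_def)
  then show ?thesis using gh hg by blast
qed

definition same_orbit :: "'a list \<Rightarrow> 'a list \<Rightarrow> bool"  (infix "\<sim>" 50)
  where "xs \<sim> ys \<longleftrightarrow> (\<exists>g\<in>Aut A. ys = map g xs)"

lemma same_orbit_length: "xs \<sim> ys \<Longrightarrow> length ys = length xs"
  by (auto simp: same_orbit_def)

lemma same_orbit_closed: "xs \<sim> ys \<Longrightarrow> set xs \<subseteq> X \<Longrightarrow> set ys \<subseteq> X"
  using Aut_closed by (fastforce simp: same_orbit_def)

lemma same_orbit_refl: "set xs \<subseteq> X \<Longrightarrow> xs \<sim> xs"
  unfolding same_orbit_def by (rule bexI[OF _ Aut_id]) (auto intro!: map_idI[symmetric])

lemma same_orbit_sym: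
  assumes "xs \<sim> ys" "set xs \<subseteq> X"
  shows "ys \<sim> xs"
proof -
  obtain g where g: "g \<in> Aut A" "ys = map g xs" using assms by (auto simp: same_orbit_def)
  obtain h where "h \<in> Aut A" "\<forall>x\<in>X. h (g x) = x" using Aut_inverse[OF g(1)] by blast
  then show ?thesis
    unfolding same_orbit_def g using assms(2) by (intro bexI[of _ h]) (auto intro!: map_idI[symmetric])
qed

lemma same_orbit_trans:
  assumes "xs \<sim> ys" "ys \<sim> zs" "set xs \<subseteq> X"
  shows "xs \<sim> zs"
proof -
  obtain g h where "g \<in> Aut A" "ys = map g xs" "h \<in> Aut A" "zs = map h ys"
    using assms by (auto simp: same_orbit_def)
  then show ?thesis
    unfolding same_orbit_def using assms(3)
    by (intro bexI[OF _ Aut_compose[of h g]]) (auto simp: compose_def)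
qed

lemma same_orbit_map: "g \<in> Aut A \<Longrightarrow> xs \<sim> map g xs"
  by (auto simp: same_orbit_def)

text \<open>An atomic type is coded by a finite combinatorial object: the length of the tuple, its pattern of
  equalities, and the relations that hold between its entries, given by their indices.\<close>
definition atomic_type :: "'a list \<Rightarrow> nat \<times> (nat \<times> nat) set \<times> ('s \<times> nat list) set" where
  "atomic_type xs =
     (length xs, {(i, j). i < length xs \<and> j < length xs \<and> xs ! i = xs ! j},
      {(s, is). sig A s = Some (length is) \<and> set is \<subseteq> {..<length xs} \<and> map ((!) xs) is \<in> intp A s})"

text \<open>Homogeneity: tuples with the same atomic type are related by an isomorphism between the
  substructures on their entries, and this isomorphism extends to an automorphism.\<close>
lemma same_orbit_iff_atomic_type:
  assumes xs: "set xs \<subseteq> X" and ys: "set ys \<subseteq> X"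
  shows "xs \<sim> ys \<longleftrightarrow> atomic_type xs = atomic_type ys"
proof
  assume "xs \<sim> ys"
  then obtain g where g: "g \<in> Aut A" "ys = map g xs" by (auto simp: same_orbit_def)
  have "ys ! i = ys ! j \<longleftrightarrow> xs ! i = xs ! j" if "i < length xs" "j < length xs" for i j
    using that g xs Aut_inj[OF g(1)] by (auto dest!: inj_onD)
  moreover have "map ((!) ys) is \<in> intp A s \<longleftrightarrow> map ((!) xs) is \<in> intp A s"
    if "sig A s = Some (length is)" "set is \<subseteq> {..<length xs}" for s "is"
  proof -
    have "map ((!) ys) is = map g (map ((!) xs) is)" using that g by (auto simp: subset_iff)
    moreover have "set (map ((!) xs) is) \<subseteq> X" using that xs by (auto simp: subset_iff)
    ultimately show ?thesis using Aut_intp[OF g(1), of s "map ((!) xs) is"] that by (simp del: map_map)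
  qed
  ultimately show "atomic_type xs = atomic_type ys"
    unfolding atomic_type_def using g(2) by auto
next
  assume eq: "atomic_type xs = atomic_type ys"
  define n where "n = length xs"
  have len: "length xs = n" "length ys = n"
    using eq by (auto simp: atomic_type_def n_def)
  have eqs: "xs ! i = xs ! j \<longleftrightarrow> ys ! i = ys ! j" if "i < n" "j < n" for i j
  proof -
    have "{(i, j). i < n \<and> j < n \<and> xs ! i = xs ! j} = {(i, j). i < n \<and> j < n \<and> ys ! i = ys ! j}"
      using eq len by (simp add: atomic_type_def)
    then have "(i, j) \<in> {(i, j). i < n \<and> j < n \<and> xs ! i = xs ! j} \<longleftrightarrow>
        (i, j) \<in> {(i, j). i < n \<and> j < n \<and> ys ! i = ys ! j}" by simp
    then show ?thesis using that by simp
  qed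
  have rels: "map ((!) xs) is \<in> intp A s \<longleftrightarrow> map ((!) ys) is \<in> intp A s"
    if "sig A s = Some (length is)" "set is \<subseteq> {..<n}" for s "is"
  proof -
    have "{(s, is). sig A s = Some (length is) \<and> set is \<subseteq> {..<n} \<and> map ((!) xs) is \<in> intp A s}
      = {(s, is). sig A s = Some (length is) \<and> set is \<subseteq> {..<n} \<and> map ((!) ys) is \<in> intp A s}"
      using eq len by (simp add: atomic_type_def)
    then have "(s, is) \<in> {(s, is). sig A s = Some (length is) \<and> set is \<subseteq> {..<n} \<and> map ((!) xs) is \<in> intp A s}
      \<longleftrightarrow> (s, is) \<in> {(s, is). sig A s = Some (length is) \<and> set is \<subseteq> {..<n} \<and> map ((!) ys) is \<in> intp A s}"
      by simp
    then show ?thesis using that by simp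
  qed
  define idx where "idx x = (SOME i. i < n \<and> xs ! i = x)" for x
  have idx: "idx x < n \<and> xs ! idx x = x" if "x \<in> set xs" for x
    unfolding idx_def by (rule someI_ex) (use that len in \<open>auto simp: in_set_conv_nth\<close>)
  define f where "f = (\<lambda>x\<in>set xs. ys ! idx x)"
  have f: "f (xs ! i) = ys ! i" if "i < n" for i
  proof -
    have "xs ! i \<in> set xs" using that len by auto
    then show ?thesis unfolding f_def using idx[of "xs ! i"] that eqs by auto
  qed
  have im: "f ` set xs = set ys"
    unfolding set_conv_nth len using f by force
  have mapf: "map f zs = map ((!) ys) (map idx zs)" "map ((!) xs) (map idx zs) = zs"
    "set (map idx zs) \<subseteq> {..<n}" if "set zs \<subseteq> set xs" for zs
    using that idx by (auto simp: f_def intro!: map_idI)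
  have "f \<in> isomorphisms (substructure_on A (set xs)) (substructure_on A (set ys))"
  proof -
    have "inj_on f (set xs)"
      using f eqs by (auto simp: inj_on_def in_set_conv_nth len)
    moreover have "zs \<in> intp A s \<longleftrightarrow> map f zs \<in> intp A s"
      if "sig A s = Some (length zs)" "set zs \<subseteq> set xs" for s zs
      using mapf[OF that(2)] rels[of s "map idx zs"] that by (simp del: map_map)
    moreover have "f \<in> set xs \<rightarrow>\<^sub>E set ys" using im by (auto simp: f_def)
    moreover have "map f zs \<in> lists (set ys)" if "set zs \<subseteq> set xs" for zs
      using that im by (auto simp: lists_eq_set)
    ultimately show ?thesis
      unfolding isomorphisms_def embeddings_def substructure_on_def
      using im by (auto simp: tuples_iff in_listsI)
  qed
  then obtain g where g: "g \<in> Aut A" "\<forall>x\<in>set xs. g x = f x"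
    using finitely_homogeneous xs ys unfolding finitely_homogeneous_def homogeneous_def by blast
  have "ys = map g xs"
    by (rule nth_equalityI) (use len g f in auto)
  then show "xs \<sim> ys" unfolding same_orbit_def using g(1) by blast
qed

text \<open>This is where the finiteness of the signature enters. It is what makes all colourings by orbits
  finite and all compactness arguments below work.\<close>
lemma finite_atomic_types: "finite (atomic_type ` {xs. set xs \<subseteq> X \<and> length xs \<le> n})"
proof -
  define D where "D = dom (sig A)"
  have fin: "finite D" using finitely_homogeneous by (simp add: D_def finitely_homogeneous_def)
  define R where "R = (SIGMA s:D. {is. set is \<subseteq> {..<n} \<and> length is = the (sig A s)})"
  have "finite R" unfolding R_def using fin by (auto intro!: finite_SigmaI finite_lists_length_eq)
  then have "finite ({..n} \<times> Pow ({..<n} \<times> {..<n}) \<times> Pow R)" by simp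
  then show ?thesis
    by (rule rev_finite_subset) (force simp: atomic_type_def R_def D_def)
qed

lemma sat_Aut:
  assumes g: "g \<in> Aut A"
  shows "formula_over (sig A) \<phi> \<Longrightarrow> (\<And>x. x \<in> free_vars \<phi> \<Longrightarrow> v x \<in> X \<and> w x = g (v x)) \<Longrightarrow>
    sat A w \<phi> \<longleftrightarrow> sat A v \<phi>"
proof (induction \<phi> arbitrary: v w)
  case (Eq x y)
  then show ?case using Aut_inj[OF g] by (auto dest: inj_onD)
next
  case (Rel s xs)
  have "map w xs = map g (map v xs)" "set (map v xs) \<subseteq> X" using Rel by auto
  then have "map g (map v xs) \<in> intp A s \<longleftrightarrow> map v xs \<in> intp A s"
    using Aut_intp[OF g, of s "map v xs"] Rel by (simp del: map_map)
  then show ?case using \<open>map w xs = _\<close> by (simp del: map_map)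
next
  case (Neg \<phi>)
  have "sat A w \<phi> = sat A v \<phi>" by (rule Neg.IH) (use Neg.prems in auto)
  then show ?case by simp
next
  case (Conj \<phi> \<psi>)
  have "sat A w \<phi> = sat A v \<phi>" by (rule Conj.IH) (use Conj.prems in auto)
  moreover have "sat A w \<psi> = sat A v \<psi>" by (rule Conj.IH) (use Conj.prems in auto)
  ultimately show ?case by simp
next
  case (Ex x \<phi>)
  have *: "sat A (w(x := g d)) \<phi> \<longleftrightarrow> sat A (v(x := d)) \<phi>" if "d \<in> X" for d
    by (rule Ex.IH) (use Ex.prems that in auto)
  have "X = g ` X" using g by (simp add: Aut_iff)
  then have "(\<exists>d\<in>X. sat A (w(x := d)) \<phi>) \<longleftrightarrow> (\<exists>d\<in>X. sat A (w(x := g d)) \<phi>)"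
    by (metis (no_types, lifting) imageE imageI)
  then show ?case using * by simp
qed

text \<open>First-order types are invariant under automorphisms, and they determine the atomic type, hence
  the orbit. This removes first-order logic from all that follows.\<close>
lemma fo_type_eq_iff:
  assumes xs: "set xs \<subseteq> X" and ys: "set ys \<subseteq> X" and len: "length xs = length ys"
  shows "fo_type A xs = fo_type A ys \<longleftrightarrow> xs \<sim> ys"
proof
  assume "xs \<sim> ys"
  then obtain g where g: "g \<in> Aut A" "ys = map g xs" by (auto simp: same_orbit_def)
  have "sat A ((!) ys) \<phi> \<longleftrightarrow> sat A ((!) xs) \<phi>" if "\<phi> \<in> formulas (sig A) (length xs)" for \<phi>
    by (rule sat_Aut[OF g(1)]) (use that g xs in \<open>auto simp: formulas_def subset_iff\<close>)
  then show "fo_type A xs = fo_type A ys"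
    using len by (auto simp: fo_type_def)
next
  assume eq: "fo_type A xs = fo_type A ys"
  have *: "sat A ((!) xs) \<phi> \<longleftrightarrow> sat A ((!) ys) \<phi>" if "\<phi> \<in> formulas (sig A) (length xs)" for \<phi>
    using eq that len unfolding fo_type_def by auto
  have "xs ! i = xs ! j \<longleftrightarrow> ys ! i = ys ! j" if "i < length xs" "j < length xs" for i j
    using *[of "Eq i j"] that by (simp add: formulas_def)
  moreover have "map ((!) xs) is \<in> intp A s \<longleftrightarrow> map ((!) ys) is \<in> intp A s"
    if "sig A s = Some (length is)" "set is \<subseteq> {..<length xs}" for s "is"
    using *[of "Rel s is"] that by (simp add: formulas_def)
  ultimately have "atomic_type xs = atomic_type ys"
    unfolding atomic_type_def using len by auto
  then show "xs \<sim> ys" using same_orbit_iff_atomic_type xs ys by blast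
qed

text \<open>Relations have bounded arity, so a bound \<open>q\<close> of at least 2 (for equality) and at least all
  arities will do. In consequence, a canonical operation is determined by its action on
  orbits of tuples of length at most \<open>q\<close>.\<close>
lemma same_orbit_if_short_subtuples:
  "\<exists>q. \<forall>xs ys. set xs \<subseteq> X \<longrightarrow> set ys \<subseteq> X \<longrightarrow> length xs = length ys \<longrightarrow>
     (\<forall>is. set is \<subseteq> {..<length xs} \<and> length is \<le> q \<longrightarrow> map ((!) xs) is \<sim> map ((!) ys) is) \<longrightarrow> xs \<sim> ys"
proof -
  define q where "q = Max (insert 2 ((\<lambda>s. the (sig A s)) ` dom (sig A)))"
  have fin: "finite (dom (sig A))" using finitely_homogeneous by (simp add: finitely_homogeneous_def)
  have qs: "n \<le> q" if "sig A s = Some n" for s n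
    unfolding q_def using that fin by (intro Max_ge) (force simp: image_iff)+
  have q2: "2 \<le> q" unfolding q_def using fin by (intro Max_ge) auto
  show ?thesis
  proof (intro exI[of _ q] allI impI)
    fix xs ys
    assume xs: "set xs \<subseteq> X" and ys: "set ys \<subseteq> X" and len: "length xs = length ys"
      and sub: "\<forall>is. set is \<subseteq> {..<length xs} \<and> length is \<le> q \<longrightarrow> map ((!) xs) is \<sim> map ((!) ys) is"
    have "xs ! i = xs ! j \<longleftrightarrow> ys ! i = ys ! j" if "i < length xs" "j < length xs" for i j
    proof -
      have "map ((!) xs) [i, j] \<sim> map ((!) ys) [i, j]" using sub[rule_format, of "[i, j]"] that q2 by simp
      then obtain g where "g \<in> Aut A" "ys ! i = g (xs ! i)" "ys ! j = g (xs ! j)"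
        by (auto simp: same_orbit_def)
      then show ?thesis using Aut_inj[of g] xs that by (auto dest!: inj_onD)
    qed
    moreover have "map ((!) xs) is \<in> intp A s \<longleftrightarrow> map ((!) ys) is \<in> intp A s"
      if "sig A s = Some (length is)" "set is \<subseteq> {..<length xs}" for s "is"
    proof -
      have "map ((!) xs) is \<sim> map ((!) ys) is" using sub that qs by simp
      then obtain g where "g \<in> Aut A" "map ((!) ys) is = map g (map ((!) xs) is)"
        by (auto simp: same_orbit_def)
      moreover have "set (map ((!) xs) is) \<subseteq> X" using that xs by (auto simp: subset_iff)
      ultimately show ?thesis using Aut_intp[of g s "map ((!) xs) is"] that by (simp del: map_map)
    qed
    ultimately have "atomic_type xs = atomic_type ys"
      unfolding atomic_type_def using len by auto
    then show "xs \<sim> ys" using same_orbit_iff_atomic_type xs ys by blast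
  qed
qed

section \<open>Limits up to automorphisms\<close>

definition conjugate_on :: "'i set \<Rightarrow> ('i \<Rightarrow> 'a) \<Rightarrow> ('i \<Rightarrow> 'a) \<Rightarrow> bool" where
  "conjugate_on P \<phi> \<psi> \<longleftrightarrow> (\<exists>u\<in>Aut A. \<forall>x\<in>P. \<psi> x = u (\<phi> x))"

lemma conjugate_on_mono: "conjugate_on P \<phi> \<psi> \<Longrightarrow> Q \<subseteq> P \<Longrightarrow> conjugate_on Q \<phi> \<psi>"
  unfolding conjugate_on_def by blast

lemma conjugate_on_refl: "\<phi> ` P \<subseteq> X \<Longrightarrow> conjugate_on P \<phi> \<phi>"
  unfolding conjugate_on_def by (rule bexI[OF _ Aut_id]) auto

lemma conjugate_on_sym: "conjugate_on P \<phi> \<psi> \<Longrightarrow> \<phi> ` P \<subseteq> X \<Longrightarrow> conjugate_on P \<psi> \<phi>"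
  unfolding conjugate_on_def by (metis Aut_inverse image_subset_iff)

lemma conjugate_on_trans:
  assumes "conjugate_on P \<phi> \<psi>" "conjugate_on P \<psi> \<chi>" "\<phi> ` P \<subseteq> X"
  shows "conjugate_on P \<phi> \<chi>"
proof -
  obtain u w where "u \<in> Aut A" "\<forall>x\<in>P. \<psi> x = u (\<phi> x)" "w \<in> Aut A" "\<forall>x\<in>P. \<chi> x = w (\<psi> x)"
    using assms unfolding conjugate_on_def by blast
  then show ?thesis
    unfolding conjugate_on_def using assms(3)
    by (intro bexI[OF _ Aut_compose[of w u]]) (auto simp: compose_def)
qed

lemma conjugate_on_cong:
  "(\<And>x. x \<in> P \<Longrightarrow> \<phi> x = \<phi>' x) \<Longrightarrow> (\<And>x. x \<in> P \<Longrightarrow> \<psi> x = \<psi>' x) \<Longrightarrow>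
     conjugate_on P \<phi> \<psi> \<longleftrightarrow> conjugate_on P \<phi>' \<psi>'"
  unfolding conjugate_on_def by auto

lemma conjugate_on_reindex:
  "conjugate_on P \<phi> \<psi> \<Longrightarrow> h ` Q \<subseteq> P \<Longrightarrow> conjugate_on Q (\<lambda>x. \<phi> (h x)) (\<lambda>x. \<psi> (h x))"
  unfolding conjugate_on_def by blast

lemma conjugate_on_set: "conjugate_on (set ps) \<phi> \<psi> \<longleftrightarrow> map \<phi> ps \<sim> map \<psi> ps"
  unfolding conjugate_on_def same_orbit_def by auto

lemma orbit_pigeonhole:
  assumes "infinite M" and t: "\<And>m. m \<in> M \<Longrightarrow> set (t m) \<subseteq> X \<and> length (t m) \<le> n"
  shows "\<exists>m0\<in>M. infinite {m \<in> M. t m0 \<sim> t m}"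
proof -
  have "finite ((\<lambda>m. atomic_type (t m)) ` M)"
    by (rule finite_subset[OF _ finite_atomic_types[of n]]) (use t in auto)
  then obtain m0 where m0: "m0 \<in> M" "infinite {m \<in> M. atomic_type (t m) = atomic_type (t m0)}"
    using pigeonhole_infinite[OF assms(1)] by blast
  have "atomic_type (t m) = atomic_type (t m0) \<longleftrightarrow> t m0 \<sim> t m" if "m \<in> M" for m
    using same_orbit_iff_atomic_type[of "t m0" "t m"] t[OF that] t[OF m0(1)] by auto
  then have "{m \<in> M. atomic_type (t m) = atomic_type (t m0)} = {m \<in> M. t m0 \<sim> t m}" by blast
  with m0 show ?thesis by auto
qed

text \<open>The values of the limit are chosen one after the other along an enumeration of the index set, so
  that each finite tuple of values lies in the orbit of the corresponding tuple of infinitely many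
  terms of the sequence. A next value exists since there are only finitely many orbits
  of longer tuples: infinitely many of the terms share one of them, and an automorphism takes one of these
  terms to the tuple of values chosen so far.\<close>
lemma limit_up_to_conjugation:
  fixes \<phi> :: "nat \<Rightarrow> 'i \<Rightarrow> 'a"
  assumes I: "countable I" and M: "infinite M" and \<phi>: "\<And>l x. l \<in> M \<Longrightarrow> x \<in> I \<Longrightarrow> \<phi> l x \<in> X"
  shows "\<exists>\<psi>. (\<forall>x\<in>I. \<psi> x \<in> X) \<and>
    (\<forall>P. finite P \<and> P \<subseteq> I \<longrightarrow> infinite {l \<in> M. conjugate_on P (\<phi> l) \<psi>})"
proof (cases "I = {}")
  case True
  then have "{l \<in> M. conjugate_on {} (\<phi> l) \<psi>} = M" for \<psi>
    using Aut_id by (auto simp: conjugate_on_def)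
  then show ?thesis using True M by auto
next
  case False
  define e where "e = from_nat_into I"
  have e: "e i \<in> I" for i unfolding e_def using False by (rule from_nat_into)
  define Q where "Q ys \<longleftrightarrow> set ys \<subseteq> X \<and>
    infinite {l \<in> M. map (\<lambda>i. \<phi> l (e i)) [0..<length ys] \<sim> ys}" for ys
  have Q0: "Q []"
    using M same_orbit_refl[of "[]"] by (simp add: Q_def)
  have Qstep: "\<exists>y. Q (ys @ [y])" if "Q ys" for ys
  proof -
    define n where "n = length ys"
    define M' where "M' = {l \<in> M. map (\<lambda>i. \<phi> l (e i)) [0..<n] \<sim> ys}"
    define t where "t l = map (\<lambda>i. \<phi> l (e i)) [0..<Suc n]" for l
    have t: "set (t l) \<subseteq> X \<and> length (t l) \<le> Suc n" if "l \<in> M" for l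
      using \<phi>[OF that] e by (auto simp: t_def simp del: upt_Suc)
    have "infinite M'" using that by (simp add: Q_def M'_def n_def)
    then obtain m0 where m0: "m0 \<in> M'" "infinite {m \<in> M'. t m0 \<sim> t m}"
      using orbit_pigeonhole[of M' t "Suc n"] t by (auto simp: M'_def)
    then obtain u where u: "u \<in> Aut A" "ys = map u (map (\<lambda>i. \<phi> m0 (e i)) [0..<n])"
      by (auto simp: M'_def same_orbit_def)
    have m0M: "m0 \<in> M" using m0(1) by (simp add: M'_def)
    \<comment> \<open>Moving the term with index \<open>m0\<close> by \<open>u\<close> makes its first \<open>n\<close> values equal to \<open>ys\<close>, and the next one
      is the value looked for.\<close>
    define y where "y = u (\<phi> m0 (e n))"
    have y: "ys @ [y] = map u (t m0)" unfolding t_def y_def u(2) by simp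
    have "set (ys @ [y]) \<subseteq> X"
      using y t[OF m0M] Aut_closed[OF u(1)] by auto
    moreover have "{m \<in> M'. t m0 \<sim> t m} \<subseteq> {l \<in> M. map (\<lambda>i. \<phi> l (e i)) [0..<length (ys @ [y])] \<sim> ys @ [y]}"
    proof clarify
      fix m assume m: "m \<in> M'" "t m0 \<sim> t m"
      then have "m \<in> M" by (simp add: M'_def)
      have "t m \<sim> t m0" using m t[OF m0M] same_orbit_sym by blast
      moreover have "t m0 \<sim> ys @ [y]" unfolding y by (rule same_orbit_map[OF u(1)])
      ultimately have "t m \<sim> ys @ [y]" using t[OF \<open>m \<in> M\<close>] same_orbit_trans by blast
      then show "m \<in> M \<and> map (\<lambda>i. \<phi> m (e i)) [0..<length (ys @ [y])] \<sim> ys @ [y]"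
        using \<open>m \<in> M\<close> by (simp add: t_def n_def)
    qed
    ultimately have "Q (ys @ [y])" unfolding Q_def using m0(2) infinite_super by blast
    then show ?thesis ..
  qed
  define Y where "Y = rec_nat [] (\<lambda>_ ys. ys @ [SOME y. Q (ys @ [y])])"
  have Y: "Y 0 = []" "Y (Suc n) = Y n @ [SOME y. Q (Y n @ [y])]" for n
    by (simp_all add: Y_def)
  have QY: "Q (Y n)" for n
  proof (induction n)
    case (Suc n)
    then show ?case unfolding Y using someI_ex[OF Qstep] by simp
  qed (simp add: Y Q0)
  define z where "z n = (SOME y. Q (Y n @ [y]))" for n
  have Yz: "Y n = map z [0..<n]" for n
    by (induction n) (simp_all add: Y z_def)
  define \<psi> where "\<psi> x = z (to_nat_on I x)" for x
  have zX: "z n \<in> X" for n using QY[of "Suc n"] by (simp add: Q_def Yz)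
  moreover have "infinite {l \<in> M. conjugate_on P (\<phi> l) \<psi>}" if P: "finite P" "P \<subseteq> I" for P
  proof -
    obtain n where n: "to_nat_on I ` P \<subseteq> {..<n}"
      using P(1) finite_nat_bounded by (metis finite_imageI)
    have "{l \<in> M. map (\<lambda>i. \<phi> l (e i)) [0..<n] \<sim> map z [0..<n]} \<subseteq> {l \<in> M. conjugate_on P (\<phi> l) \<psi>}"
    proof clarify
      fix l assume "map (\<lambda>i. \<phi> l (e i)) [0..<n] \<sim> map z [0..<n]"
      then have "conjugate_on (set [0..<n]) (\<lambda>i. \<phi> l (e i)) z"
        unfolding conjugate_on_set .
      then have "conjugate_on P (\<lambda>x. \<phi> l (e (to_nat_on I x))) \<psi>"
        unfolding \<psi>_def by (rule conjugate_on_reindex) (use n in auto)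
      then show "conjugate_on P (\<phi> l) \<psi>"
        by (rule conjugate_on_cong[THEN iffD1, rotated -1]) (use P I in \<open>auto simp: e_def\<close>)
    qed
    then show ?thesis using QY[of n] infinite_super unfolding Q_def Yz by (auto simp del: upt_Suc)
  qed
  ultimately show ?thesis by (intro exI[of _ \<psi>]) (auto simp: \<psi>_def)
qed

text \<open>A fixed increasing chain of finite sets that exhausts the domain. It serves to choose one object for
  each of countably many finite sets, before a limit is taken.\<close>
definition segment :: "nat \<Rightarrow> 'a set" where
  "segment l = {x \<in> X. to_nat_on X x < l}"

lemma finite_segment: "finite (segment l)"
proof (rule finite_imageD)
  show "finite (to_nat_on X ` segment l)"
    by (rule finite_subset[of _ "{..<l}"]) (auto simp: segment_def)
  show "inj_on (to_nat_on X) (segment l)"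
    using inj_on_to_nat_on[OF countable_univ] by (rule inj_on_subset) (auto simp: segment_def)
qed

lemma segment_subset: "segment l \<subseteq> X"
  by (auto simp: segment_def)

lemma segment_mono: "k \<le> l \<Longrightarrow> segment k \<subseteq> segment l"
  by (auto simp: segment_def)

lemma segments_exhaust:
  assumes "finite P" "P \<subseteq> X"
  shows "\<exists>l. P \<subseteq> segment l"
proof -
  obtain n where "to_nat_on X ` P \<subseteq> {..<n}"
    using assms(1) finite_nat_bounded by (metis finite_imageI)
  then show ?thesis using assms(2) by (intro exI[of _ n]) (fastforce simp: segment_def)
qed

section \<open>Operations, interpolation and canonicity\<close>

definition orbit_preserving :: "('a \<Rightarrow> 'a) \<Rightarrow> bool" where
  "orbit_preserving v \<longleftrightarrow> (\<forall>xs. set xs \<subseteq> X \<longrightarrow> xs \<sim> map v xs)"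

lemma orbit_preserving_Aut: "v \<in> Aut A \<Longrightarrow> orbit_preserving v"
  by (simp add: orbit_preserving_def same_orbit_map)

lemma orbit_preserving_closed: "orbit_preserving v \<Longrightarrow> x \<in> X \<Longrightarrow> v x \<in> X"
  using same_orbit_closed[of "[x]" "map v [x]"] orbit_preserving_def[of v, THEN iffD1, rule_format, of "[x]"]
  by auto

lemma orbit_preserving_comp:
  assumes "orbit_preserving v" "orbit_preserving w"
  shows "orbit_preserving (\<lambda>x. v (w x))"
  unfolding orbit_preserving_def
proof (intro allI impI)
  fix xs assume xs: "set xs \<subseteq> X"
  have "xs \<sim> map w xs" using assms(2) xs by (simp add: orbit_preserving_def)
  moreover have "set (map w xs) \<subseteq> X" using assms(2) xs orbit_preserving_closed by auto
  then have "map w xs \<sim> map v (map w xs)" using assms(1) orbit_preserving_def by blast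
  ultimately have "xs \<sim> map v (map w xs)" using xs same_orbit_trans by blast
  then show "xs \<sim> map (\<lambda>x. v (w x)) xs" by (simp add: comp_def)
qed

text \<open>So these maps are the pointwise limits of automorphisms, and they may replace automorphisms
  wherever only finite sets matter, as in the definition of interpolation.\<close>
lemma orbit_preserving_finite:
  assumes "orbit_preserving v" "finite F" "F \<subseteq> X"
  shows "\<exists>g\<in>Aut A. \<forall>x\<in>F. v x = g x"
proof -
  obtain xs where "set xs = F" using assms(2) finite_list by blast
  moreover then have "xs \<sim> map v xs" using assms by (auto simp: orbit_preserving_def)
  ultimately show ?thesis unfolding same_orbit_def by auto
qed

definition twist :: "'a operation \<Rightarrow> (nat \<Rightarrow> 'a \<Rightarrow> 'a) \<Rightarrow> 'a operation" where
  "twist f v = Operation (arity f)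
     (\<lambda>xs\<in>tuples X (arity f). fn f (map (\<lambda>i. v i (xs ! i)) [0..<arity f]))"

lemma arity_twist [simp]: "arity (twist f v) = arity f"
  by (simp add: twist_def)

lemma map_indices_in_tuples: "(\<And>i. i < n \<Longrightarrow> h i \<in> S) \<Longrightarrow> map h [0..<n] \<in> tuples S n"
  by (auto simp: tuples_iff)

lemma nth_in_tuples: "xs \<in> tuples S n \<Longrightarrow> i < n \<Longrightarrow> xs ! i \<in> S"
  by (auto simp: tuples_iff)

lemma tuples_mono: "S \<subseteq> T \<Longrightarrow> tuples S n \<subseteq> tuples T n"
  unfolding tuples_def by blast

lemma finite_tuples: "finite S \<Longrightarrow> finite (tuples S n)"
  unfolding tuples_def by (rule finite_lists_length_eq)

lemma fn_twist:
  "xs \<in> tuples X (arity f) \<Longrightarrow> fn (twist f v) xs = fn f (map (\<lambda>i. v i (xs ! i)) [0..<arity f])"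
  by (simp add: twist_def)

lemma operations_closed: "f \<in> operations X \<Longrightarrow> xs \<in> tuples X (arity f) \<Longrightarrow> fn f xs \<in> X"
  by (auto simp: operations_def)

lemma twisted_arguments:
  assumes "\<And>i. i < n \<Longrightarrow> orbit_preserving (v i)" "xs \<in> tuples X n"
  shows "map (\<lambda>i. v i (xs ! i)) [0..<n] \<in> tuples X n"
proof (rule map_indices_in_tuples)
  fix i assume i: "i < n"
  show "v i (xs ! i) \<in> X"
    by (rule orbit_preserving_closed[OF assms(1)[OF i] nth_in_tuples[OF assms(2) i]])
qed

lemma operations_twist:
  assumes "f \<in> operations X" "\<And>i. i < arity f \<Longrightarrow> orbit_preserving (v i)"
  shows "twist f v \<in> operations X"
proof -
  have "fn f (map (\<lambda>i. v i (xs ! i)) [0..<arity f]) \<in> X" if "xs \<in> tuples X (arity f)" for xs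
    by (rule operations_closed[OF assms(1)], rule twisted_arguments) (use assms(2) that in auto)
  then show ?thesis using assms(1) by (auto simp: operations_def twist_def)
qed

lemma twist_twist:
  assumes "\<And>i. i < arity f \<Longrightarrow> orbit_preserving (w i)"
  shows "twist (twist f v) w = twist f (\<lambda>i x. v i (w i x))"
proof -
  have "map (\<lambda>i. w i (xs ! i)) [0..<arity f] \<in> tuples X (arity f)" if "xs \<in> tuples X (arity f)" for xs
    using assms that by (rule twisted_arguments)
  moreover have "map (\<lambda>i. v i (map (\<lambda>i. w i (xs ! i)) [0..<n] ! i)) [0..<n] =
      map (\<lambda>i. v i (w i (xs ! i))) [0..<n]" for xs n
    by simp
  ultimately show ?thesis unfolding twist_def by (auto intro!: restrict_ext simp del: map_eq_conv)
qed

text \<open>In contrast to automorphisms, the inner maps are here allowed to be non-surjective. This makes it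
  possible to interpolate inside a proper copy of the structure.\<close>
lemma interpolates_iff:
  assumes "f \<in> operations X"
  shows "interpolates X (Aut A) f g \<longleftrightarrow> arity f = arity g \<and>
    (\<forall>F. finite F \<and> F \<subseteq> X \<longrightarrow> (\<exists>v. (\<forall>i<arity f. orbit_preserving (v i)) \<and>
       conjugate_on (tuples F (arity f)) (fn (twist f v)) (fn g)))"
    (is "_ \<longleftrightarrow> _ \<and> ?R")
proof (intro iffI conjI)
  assume "interpolates X (Aut A) f g"
  then show "arity f = arity g" by (simp add: interpolates_def)
  show ?R
  proof (intro allI impI)
    fix F assume F: "finite F \<and> F \<subseteq> X"
    then have "\<exists>u\<in>Aut A. \<exists>v\<in>{..<arity f} \<rightarrow> Aut A. \<forall>xs\<in>tuples F (arity f).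
        fn g xs = u (fn f (map (\<lambda>i. v i (xs ! i)) [0..<arity f]))"
      using \<open>interpolates X (Aut A) f g\<close> unfolding interpolates_def using F by (elim conjE allE[where x=F] impE) auto
    then obtain u v where "u \<in> Aut A" "v \<in> {..<arity f} \<rightarrow> Aut A"
      "\<forall>xs\<in>tuples F (arity f). fn g xs = u (fn f (map (\<lambda>i. v i (xs ! i)) [0..<arity f]))"
      by (elim bexE)
    moreover have "tuples F (arity f) \<subseteq> tuples X (arity f)" using F by (intro tuples_mono) auto
    ultimately show "\<exists>v. (\<forall>i<arity f. orbit_preserving (v i)) \<and>
       conjugate_on (tuples F (arity f)) (fn (twist f v)) (fn g)"
      unfolding conjugate_on_def
      by (intro exI[of _ v] conjI bexI[of _ u]) (auto simp: fn_twist intro!: orbit_preserving_Aut)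
  qed
next
  assume R: "arity f = arity g \<and> ?R"
  show "interpolates X (Aut A) f g" unfolding interpolates_def
  proof (intro conjI allI impI)
    show "arity f = arity g" using R by simp
    fix F assume F: "finite F \<and> F \<subseteq> X"
    obtain v where v: "\<And>i. i < arity f \<Longrightarrow> orbit_preserving (v i)"
      and c: "conjugate_on (tuples F (arity f)) (fn (twist f v)) (fn g)"
      using R[THEN conjunct2, rule_format, OF F] by auto
    obtain u where u: "u \<in> Aut A" "\<forall>xs\<in>tuples F (arity f). fn g xs = u (fn (twist f v) xs)"
      using c by (auto simp: conjugate_on_def)
    have "\<exists>w\<in>Aut A. \<forall>x\<in>F. v i x = w x" if "i < arity f" for i
      using orbit_preserving_finite[OF v[OF that]] F by blast
    then obtain w where w: "\<And>i. i < arity f \<Longrightarrow> w i \<in> Aut A \<and> (\<forall>x\<in>F. v i x = w i x)" by metis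
    have sub: "tuples F (arity f) \<subseteq> tuples X (arity f)" using F by (intro tuples_mono) auto
    have "fn g xs = u (fn f (map (\<lambda>i. w i (xs ! i)) [0..<arity f]))" if "xs \<in> tuples F (arity f)" for xs
    proof -
      have "map (\<lambda>i. v i (xs ! i)) [0..<arity f] = map (\<lambda>i. w i (xs ! i)) [0..<arity f]"
        using w nth_in_tuples[OF that] by auto
      moreover have "xs \<in> tuples X (arity f)" using that sub by blast
      ultimately show ?thesis using u that fn_twist[of xs f v] by (simp del: map_eq_conv)
    qed
    then show "\<exists>u\<in>Aut A. \<exists>v\<in>{..<arity f} \<rightarrow> Aut A. \<forall>xs\<in>tuples F (arity f).
           fn g xs = u (fn f (map (\<lambda>i. v i (xs ! i)) [0..<arity f]))"
      using u(1) w by (intro bexI[of _ u] bexI[of _ w]) auto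
  qed
qed

lemma interpolates_twistD:
  assumes f: "f \<in> operations X" and v: "\<And>i. i < arity f \<Longrightarrow> orbit_preserving (v i)"
    and "interpolates X (Aut A) (twist f v) g"
  shows "interpolates X (Aut A) f g"
proof -
  have 1: "arity f = arity g" and 2: "\<And>F. finite F \<Longrightarrow> F \<subseteq> X \<Longrightarrow> \<exists>w. (\<forall>i<arity f. orbit_preserving (w i)) \<and>
       conjugate_on (tuples F (arity f)) (fn (twist (twist f v) w)) (fn g)"
    using assms(3) interpolates_iff[OF operations_twist[OF f v]] by auto
  show ?thesis unfolding interpolates_iff[OF f]
  proof (intro conjI allI impI 1)
    fix F assume "finite F \<and> F \<subseteq> X"
    then obtain w where w: "\<forall>i<arity f. orbit_preserving (w i)"
      "conjugate_on (tuples F (arity f)) (fn (twist (twist f v) w)) (fn g)" using 2 by blast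
    then show "\<exists>w. (\<forall>i<arity f. orbit_preserving (w i)) \<and>
       conjugate_on (tuples F (arity f)) (fn (twist f w)) (fn g)"
      using twist_twist[of f w v] v by (intro exI[of _ "\<lambda>i x. v i (w i x)"]) (auto intro: orbit_preserving_comp)
  qed
qed

lemma interpolates_refl:
  assumes "f \<in> operations X"
  shows "interpolates X (Aut A) f f"
  unfolding interpolates_iff[OF assms]
proof (intro conjI allI impI refl)
  fix F assume F: "finite F \<and> F \<subseteq> X"
  have c: "conjugate_on (tuples F (arity f)) (fn f) (fn f)"
    using operations_closed[OF assms] tuples_mono F by (intro conjugate_on_refl) blast
  have eq: "fn (twist f (\<lambda>_ x. x)) xs = fn f xs" if "xs \<in> tuples F (arity f)" for xs
  proof -
    have "xs \<in> tuples X (arity f)" using that tuples_mono F by blast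
    moreover have "map (\<lambda>i. xs ! i) [0..<arity f] = xs"
      using that map_nth[of xs] by (simp add: tuples_iff)
    ultimately show ?thesis by (simp add: fn_twist)
  qed
  from c have "conjugate_on (tuples F (arity f)) (fn (twist f (\<lambda>_ x. x))) (fn f)"
    by (rule conjugate_on_cong[THEN iffD2, rotated -1]) (use eq in auto)
  then show "\<exists>v. (\<forall>i<arity f. orbit_preserving (v i)) \<and>
       conjugate_on (tuples F (arity f)) (fn (twist f v)) (fn f)"
    by (intro exI[of _ "\<lambda>_ x. x"]) (auto simp: orbit_preserving_def same_orbit_refl)
qed

lemma apply_componentwise_tuples:
  assumes "f \<in> operations X" "as \<in> tuples (tuples X n) (arity f)"
  shows "apply_componentwise f n as \<in> tuples X n"
proof -
  have "map (\<lambda>a. a ! j) as \<in> tuples X (arity f)" if "j < n" for j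
    using assms(2) that by (auto simp: tuples_iff subset_iff)
  then show ?thesis
    unfolding apply_componentwise_def using operations_closed[OF assms(1)]
    by (intro map_indices_in_tuples) auto
qed

lemma canonical_iff:
  assumes f: "f \<in> operations X"
  shows "canonical A f \<longleftrightarrow>
     (\<forall>n. \<forall>as\<in>tuples (tuples X n) (arity f). \<forall>bs\<in>tuples (tuples X n) (arity f).
        (\<forall>i<arity f. as ! i \<sim> bs ! i) \<longrightarrow> apply_componentwise f n as \<sim> apply_componentwise f n bs)"
proof -
  have *: "fo_type A a = fo_type A b \<longleftrightarrow> a \<sim> b" if "a \<in> tuples X n" "b \<in> tuples X n" for a b n
    using that by (intro fo_type_eq_iff) (auto simp: tuples_iff)
  show ?thesis
    unfolding canonical_def
  proof (intro iff_allI ball_cong refl)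
    fix n as bs
    assume as: "as \<in> tuples (tuples X n) (arity f)" and bs: "bs \<in> tuples (tuples X n) (arity f)"
    have 1: "(\<forall>i<arity f. fo_type A (as ! i) = fo_type A (bs ! i)) \<longleftrightarrow> (\<forall>i<arity f. as ! i \<sim> bs ! i)"
      using *[OF nth_in_tuples[OF as] nth_in_tuples[OF bs]] by auto
    have 2: "fo_type A (apply_componentwise f n as) = fo_type A (apply_componentwise f n bs) \<longleftrightarrow>
        apply_componentwise f n as \<sim> apply_componentwise f n bs"
      by (rule *[OF apply_componentwise_tuples[OF f as] apply_componentwise_tuples[OF f bs]])
    show "((\<forall>i<arity f. fo_type A (as ! i) = fo_type A (bs ! i)) \<longrightarrow>
        fo_type A (apply_componentwise f n as) = fo_type A (apply_componentwise f n bs)) \<longleftrightarrow>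
      ((\<forall>i<arity f. as ! i \<sim> bs ! i) \<longrightarrow> apply_componentwise f n as \<sim> apply_componentwise f n bs)"
      unfolding 1 2 ..
  qed
qed

lemma operations_minor:
  assumes "f \<in> operations X" "\<alpha> \<in> {..<arity f} \<rightarrow> {..<k}"
  shows "minor X k \<alpha> f \<in> operations X"
proof -
  have "\<alpha> 0 < k" using assms by (auto simp: operations_def Pi_iff)
  then have "0 < k" by simp
  moreover have "fn f (map (\<lambda>i. xs ! \<alpha> i) [0..<arity f]) \<in> X" if "xs \<in> tuples X k" for xs
    using assms that by (intro operations_closed[OF assms(1)] map_indices_in_tuples nth_in_tuples[OF that]) auto
  ultimately show ?thesis by (auto simp: operations_def minor_def)
qed

lemma Can_minor:
  assumes "f \<in> Can A" "\<alpha> \<in> {..<arity f} \<rightarrow> {..<k}"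
  shows "minor X k \<alpha> f \<in> Can A"
proof -
  have f: "f \<in> operations X" "canonical A f" using assms(1) by (auto simp: Can_def)
  note m = operations_minor[OF f(1) assms(2)]
  have eq: "apply_componentwise (minor X k \<alpha> f) n as =
      apply_componentwise f n (map (\<lambda>i. as ! \<alpha> i) [0..<arity f])"
    if as: "as \<in> tuples (tuples X n) k" for n as
  proof -
    have "map (\<lambda>a. a ! j) as \<in> tuples X k" if "j < n" for j
      using as that by (auto simp: tuples_iff subset_iff)
    moreover have "map (\<lambda>a. a ! j) as ! \<alpha> i = as ! \<alpha> i ! j" if "i < arity f" for i j
      using as assms(2) that by (auto simp: tuples_iff Pi_iff)
    ultimately show ?thesis
      by (auto simp: apply_componentwise_def minor_def comp_def intro!: arg_cong[where f="fn f"])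
  qed
  have "apply_componentwise (minor X k \<alpha> f) n as \<sim> apply_componentwise (minor X k \<alpha> f) n bs"
    if as: "as \<in> tuples (tuples X n) k" and bs: "bs \<in> tuples (tuples X n) k"
      and "\<forall>i<k. as ! i \<sim> bs ! i" for n as bs
  proof -
    have "map (\<lambda>i. cs ! \<alpha> i) [0..<arity f] \<in> tuples (tuples X n) (arity f)"
      if "cs \<in> tuples (tuples X n) k" for cs
      using assms(2) by (intro map_indices_in_tuples nth_in_tuples[OF that]) auto
    then show ?thesis unfolding eq[OF as] eq[OF bs]
      using f(2)[unfolded canonical_iff[OF f(1)]] that assms(2) by (simp add: Pi_iff)
  qed
  then show ?thesis using m by (simp add: Can_def canonical_iff[OF m]) (simp add: minor_def)
qed

end

section \<open>Polymorphisms of reducts\<close>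

locale reduct_structure = finitely_homogeneous_structure A
  for A :: "('s, 'a) struct" +
  fixes B :: "('t, 'a) struct"
  assumes reduct: "reduct B A"
begin

lemma univ_reduct: "univ B = X"
  using reduct by (simp add: reduct_def)

lemma reduct_intp_tuples: "sig B s = Some n \<Longrightarrow> intp B s \<subseteq> tuples X n"
  using reduct unfolding reduct_def is_structure_def by metis

text \<open>The relations of a reduct are first-order definable, hence unions of orbits.\<close>
lemma reduct_intp_orbit:
  assumes "sig B s = Some n" "xs \<in> intp B s" "xs \<sim> ys"
  shows "ys \<in> intp B s"
proof -
  have xs: "xs \<in> tuples X n" using reduct_intp_tuples assms by blast
  then have ys: "ys \<in> tuples X n"
    using same_orbit_closed[OF assms(3)] same_orbit_length[OF assms(3)] by (auto simp: tuples_iff)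
  obtain \<phi> where "intp B s = {xs \<in> tuples X n. \<phi> \<in> fo_type A xs}"
    using reduct assms(1) unfolding reduct_def by blast
  moreover have "fo_type A xs = fo_type A ys"
    using fo_type_eq_iff[of xs ys] xs ys assms(3) by (auto simp: tuples_iff)
  ultimately show ?thesis using assms(2) ys by auto
qed

lemma Pol_iff:
  "f \<in> Pol B \<longleftrightarrow> f \<in> operations X \<and>
     (\<forall>s k ts. sig B s = Some k \<longrightarrow> ts \<in> tuples (tuples X (arity f)) k \<longrightarrow>
        (\<forall>i<arity f. map (\<lambda>t. t ! i) ts \<in> intp B s) \<longrightarrow> map (fn f) ts \<in> intp B s)"
  unfolding Pol_def homomorphisms_def power_structure_def operations_def univ_reduct
  by (auto simp: dom_def)

lemma Pol_operations: "f \<in> Pol B \<Longrightarrow> f \<in> operations X"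
  by (simp add: Pol_iff)

lemma Pol_preserves:
  "f \<in> Pol B \<Longrightarrow> sig B s = Some k \<Longrightarrow> ts \<in> tuples (tuples X (arity f)) k \<Longrightarrow>
    (\<And>i. i < arity f \<Longrightarrow> map (\<lambda>t. t ! i) ts \<in> intp B s) \<Longrightarrow> map (fn f) ts \<in> intp B s"
  by (simp add: Pol_iff)

lemma Pol_twist:
  assumes f: "f \<in> Pol B" and v: "\<And>i. i < arity f \<Longrightarrow> orbit_preserving (v i)"
  shows "twist f v \<in> Pol B"
  unfolding Pol_iff arity_twist
proof (intro conjI allI impI)
  show "twist f v \<in> operations X" using operations_twist Pol_operations f v by blast
  fix s k ts
  assume s: "sig B s = Some k" and ts: "ts \<in> tuples (tuples X (arity f)) k"
    and rel: "\<forall>i<arity f. map (\<lambda>t. t ! i) ts \<in> intp B s"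
  define h where "h t = map (\<lambda>i. v i (t ! i)) [0..<arity f]" for t
  have "map (fn (twist f v)) ts = map (fn f) (map h ts)"
    using ts by (auto simp: h_def tuples_iff[of _ "tuples X (arity f)"] fn_twist)
  moreover have "map (fn f) (map h ts) \<in> intp B s"
  proof (rule Pol_preserves[OF f s])
    show "map h ts \<in> tuples (tuples X (arity f)) k"
    proof -
      have "h t \<in> tuples X (arity f)" if "t \<in> tuples X (arity f)" for t
        unfolding h_def using v that by (rule twisted_arguments)
      then show ?thesis using ts by (auto simp: tuples_iff[of _ _ k])
    qed
    fix i assume i: "i < arity f"
    have "map (\<lambda>t. t ! i) (map h ts) = map (v i) (map (\<lambda>t. t ! i) ts)"
      using i by (auto simp: h_def)
    moreover have "set (map (\<lambda>t. t ! i) ts) \<subseteq> X"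
      using rel[rule_format, OF i] reduct_intp_tuples[OF s] unfolding tuples_def by blast
    ultimately have "map (\<lambda>t. t ! i) ts \<sim> map (\<lambda>t. t ! i) (map h ts)"
      using v[OF i] unfolding orbit_preserving_def by metis
    then show "map (\<lambda>t. t ! i) (map h ts) \<in> intp B s"
      using reduct_intp_orbit[OF s] rel i by blast
  qed
  ultimately show "map (fn (twist f v)) ts \<in> intp B s" by (simp only:)
qed

lemma Pol_minor:
  assumes f: "f \<in> Pol B" and \<alpha>: "\<alpha> \<in> {..<arity f} \<rightarrow> {..<k}"
  shows "minor X k \<alpha> f \<in> Pol B"
  unfolding Pol_iff
proof (intro conjI allI impI)
  show "minor X k \<alpha> f \<in> operations X" using operations_minor Pol_operations f \<alpha> by blast
  fix s m ts
  assume s: "sig B s = Some m" and ts': "ts \<in> tuples (tuples X (arity (minor X k \<alpha> f))) m"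
    and rel': "\<forall>i<arity (minor X k \<alpha> f). map (\<lambda>t. t ! i) ts \<in> intp B s"
  have ts: "ts \<in> tuples (tuples X k) m" and rel: "\<forall>i<k. map (\<lambda>t. t ! i) ts \<in> intp B s"
    using ts' rel' by (simp_all add: minor_def)
  define h where "h t = map (\<lambda>i. t ! \<alpha> i) [0..<arity f]" for t :: "'a list"
  have "map (fn (minor X k \<alpha> f)) ts = map (fn f) (map h ts)"
    using ts by (auto simp: h_def tuples_iff[of _ "tuples X k"] minor_def)
  moreover have "map (fn f) (map h ts) \<in> intp B s"
  proof (rule Pol_preserves[OF f s])
    have "h t \<in> tuples X (arity f)" if "t \<in> tuples X k" for t
      unfolding h_def using \<alpha> by (intro map_indices_in_tuples nth_in_tuples[OF that]) auto
    then show "map h ts \<in> tuples (tuples X (arity f)) m"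
      using ts by (auto simp: tuples_iff[of _ _ m])
    fix i assume i: "i < arity f"
    have "map (\<lambda>t. t ! i) (map h ts) = map (\<lambda>t. t ! \<alpha> i) ts"
      using i by (auto simp: h_def)
    moreover have "map (\<lambda>t. t ! \<alpha> i) ts \<in> intp B s" using rel \<alpha> i by (auto simp: Pi_iff)
    ultimately show "map (\<lambda>t. t ! i) (map h ts) \<in> intp B s" by (simp only:)
  qed
  ultimately show "map (fn (minor X k \<alpha> f)) ts \<in> intp B s" by (simp only:)
qed

text \<open>Polymorphisms are characterised by finite restrictions up to automorphisms, so the limit of a
  sequence of polymorphisms is again one.\<close>
lemma Pol_limit:
  fixes f :: "nat \<Rightarrow> 'a operation"
  assumes f: "\<And>l. l \<in> M \<Longrightarrow> f l \<in> Pol B \<and> arity (f l) = n" and M: "infinite M"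
  shows "\<exists>g\<in>Pol B. arity g = n \<and>
    (\<forall>P. finite P \<and> P \<subseteq> tuples X n \<longrightarrow> infinite {l \<in> M. conjugate_on P (fn (f l)) (fn g)})"
proof -
  have "countable (tuples X n)"
    by (rule countable_subset[of _ "lists X"]) (auto simp: tuples_iff countable_univ)
  moreover have "fn (f l) xs \<in> X" if "l \<in> M" "xs \<in> tuples X n" for l xs
    using f[OF that(1)] that(2) Pol_operations operations_closed by blast
  ultimately obtain \<psi> where \<psi>: "\<forall>x\<in>tuples X n. \<psi> x \<in> X"
    "\<And>P. finite P \<and> P \<subseteq> tuples X n \<Longrightarrow> infinite {l \<in> M. conjugate_on P (fn (f l)) \<psi>}"
    using limit_up_to_conjugation[of "tuples X n" M "\<lambda>l. fn (f l)"] M by blast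
  define g where "g = Operation n (\<lambda>x\<in>tuples X n. \<psi> x)"
  have ag: "arity g = n" by (simp add: g_def)
  have lim: "infinite {l \<in> M. conjugate_on P (fn (f l)) (fn g)}" if P: "finite P" "P \<subseteq> tuples X n" for P
  proof -
    have "conjugate_on P (fn (f l)) (fn g) \<longleftrightarrow> conjugate_on P (fn (f l)) \<psi>" for l
      by (rule conjugate_on_cong) (use P in \<open>auto simp: g_def\<close>)
    then show ?thesis using \<psi>(2) P by simp
  qed
  have "g \<in> Pol B" unfolding Pol_iff ag
  proof (intro conjI allI impI)
    obtain l where "l \<in> M" using M by fastforce
    then show "g \<in> operations X"
      using f[of l] Pol_operations[of "f l"] \<psi>(1) by (auto simp: operations_def g_def)
    fix s k ts
    assume s: "sig B s = Some k" and ts: "ts \<in> tuples (tuples X n) k"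
      and rel: "\<forall>i<n. map (\<lambda>t. t ! i) ts \<in> intp B s"
    obtain l where l: "l \<in> M" "conjugate_on (set ts) (fn (f l)) (fn g)"
      using lim[of "set ts"] ts by (auto simp: tuples_iff[of _ _ k] dest!: infinite_imp_nonempty)
    have "map (fn (f l)) ts \<in> intp B s"
      using Pol_preserves[of "f l" s k ts] f[OF l(1)] s ts rel by auto
    moreover have "map (fn (f l)) ts \<sim> map (fn g) ts" using l(2) conjugate_on_set by blast
    ultimately show "map (fn g) ts \<in> intp B s" using reduct_intp_orbit[OF s] by blast
  qed
  then show ?thesis using ag lim by blast
qed

end

context finitely_homogeneous_structure
begin

section \<open>The Ramsey property for colourings of tuples\<close>

text \<open>The age consists of structures on natural numbers. The lemmas about embeddings translate between
  them and finite subsets of the domain.\<close>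

lemma age_copy:
  assumes S: "finite S" "S \<subseteq> X"
  shows "\<exists>K\<in>age A. \<exists>\<iota>\<in>embeddings K A. \<iota> ` univ K = S"
proof -
  obtain e where e: "bij_betw e {0..<card S} S"
    using ex_bij_betw_nat_finite[OF S(1)] by blast
  define \<iota> where "\<iota> = (\<lambda>i\<in>{0..<card S}. e i)"
  define K where "K = \<lparr>univ = {0..<card S}, sig = sig A,
    intp = (\<lambda>s. {is. set is \<subseteq> {0..<card S} \<and> map \<iota> is \<in> intp A s})\<rparr>"
  have K: "univ K = {0..<card S}" "sig K = sig A"
    "intp K s = {is. set is \<subseteq> {0..<card S} \<and> map \<iota> is \<in> intp A s}" for s
    by (simp_all add: K_def)
  have im: "\<iota> ` univ K = S" and inj: "inj_on \<iota> (univ K)"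
    using e by (auto simp: K \<iota>_def bij_betw_def inj_on_def)
  have "is_structure K" unfolding is_structure_def
  proof (intro allI impI subsetI)
    fix s n "is" assume s: "sig K s = Some n" and "is": "is \<in> intp K s"
    then have "map \<iota> is \<in> tuples X n"
      using is_structure unfolding is_structure_def K by auto
    then show "is \<in> tuples (univ K) n" using "is" by (auto simp: tuples_iff K)
  qed
  moreover have "\<iota> \<in> embeddings K A"
    unfolding embeddings_def using im inj S by (auto simp: tuples_iff K \<iota>_def)
  ultimately have "K \<in> age A" "\<iota> \<in> embeddings K A"
    by (auto simp: age_def K)
  then show ?thesis using im by blast
qed

lemma embeddings_closed: "f \<in> embeddings K L \<Longrightarrow> p \<in> univ K \<Longrightarrow> f p \<in> univ L"
  by (auto simp: embeddings_def)

lemma embeddings_intp: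
  "f \<in> embeddings K L \<Longrightarrow> sig K s = Some (length xs) \<Longrightarrow> set xs \<subseteq> univ K \<Longrightarrow>
     map f xs \<in> intp L s \<longleftrightarrow> xs \<in> intp K s"
  unfolding embeddings_def by (simp add: tuples_iff)

lemma embeddings_compose:
  assumes f: "f \<in> embeddings K L" and g: "g \<in> embeddings L M" and sig: "sig L = sig K"
  shows "compose (univ K) g f \<in> embeddings K M"
proof -
  have "inj_on (compose (univ K) g f) (univ K)"
  proof (rule inj_onI)
    fix p q assume pq: "p \<in> univ K" "q \<in> univ K" "compose (univ K) g f p = compose (univ K) g f q"
    have "inj_on f (univ K)" "inj_on g (univ L)" using f g by (auto simp: embeddings_def)
    then show "p = q" using pq embeddings_closed[OF f] by (auto simp: compose_def inj_on_eq_iff)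
  qed
  moreover have "map (compose (univ K) g f) xs \<in> intp M s \<longleftrightarrow> xs \<in> intp K s"
    if "sig K s = Some (length xs)" "set xs \<subseteq> univ K" for s xs
  proof -
    have "map (compose (univ K) g f) xs = map g (map f xs)" using that by (auto simp: compose_def)
    moreover have "set (map f xs) \<subseteq> univ L" using embeddings_closed[OF f] that by auto
    ultimately show ?thesis
      using embeddings_intp[OF f that] embeddings_intp[OF g, of s "map f xs"] that sig
      by (simp del: map_map)
  qed
  moreover have "compose (univ K) g f \<in> univ K \<rightarrow>\<^sub>E univ M"
    using embeddings_closed[OF f] embeddings_closed[OF g] by (auto simp: compose_def)
  ultimately show ?thesis by (auto simp: embeddings_def tuples_iff)
qed

lemma embeddings_factor:
  assumes j: "j \<in> embeddings K A" and \<iota>: "\<iota> \<in> embeddings L A" and sub: "j ` univ K \<subseteq> \<iota> ` univ L"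
    and sig: "sig K = sig A" "sig L = sig A"
  shows "\<exists>f\<in>embeddings K L. \<forall>p\<in>univ K. \<iota> (f p) = j p"
proof -
  define f where "f = (\<lambda>p\<in>univ K. inv_into (univ L) \<iota> (j p))"
  have f: "f p \<in> univ L" "\<iota> (f p) = j p" if "p \<in> univ K" for p
    using that sub by (auto simp: f_def inv_into_into f_inv_into_f image_subset_iff)
  have "inj_on f (univ K)"
  proof (rule inj_onI)
    fix p q assume "p \<in> univ K" "q \<in> univ K" "f p = f q"
    then show "p = q" using f j by (metis (no_types, lifting) embeddings_def inj_onD mem_Collect_eq)
  qed
  moreover have "map f xs \<in> intp L s \<longleftrightarrow> xs \<in> intp K s"
    if "sig K s = Some (length xs)" "set xs \<subseteq> univ K" for s xs
  proof -
    have "map \<iota> (map f xs) = map j xs" using that f by (auto simp: subset_iff)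
    moreover have "set (map f xs) \<subseteq> univ L" using f that by auto
    ultimately show ?thesis
      using embeddings_intp[OF j that] embeddings_intp[OF \<iota>, of s "map f xs"] that sig
      by (simp del: map_map)
  qed
  ultimately have "f \<in> embeddings K L"
    using f by (auto simp: embeddings_def tuples_iff f_def)
  then show ?thesis using f by blast
qed

text \<open>Homogeneity in terms of the age: two embeddings of the same structure differ by an automorphism on
  every finite tuple.\<close>
lemma embeddings_same_orbit:
  assumes f: "f \<in> embeddings K A" and g: "g \<in> embeddings K A" and sig: "sig K = sig A"
    and ps: "set ps \<subseteq> univ K"
  shows "map f ps \<sim> map g ps"
proof -
  have fX: "set (map f ps) \<subseteq> X" "set (map g ps) \<subseteq> X"
    using embeddings_closed[OF f] embeddings_closed[OF g] ps by auto
  have inj: "inj_on f (univ K)" "inj_on g (univ K)" using f g by (auto simp: embeddings_def)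
  have psK: "ps ! i \<in> univ K" if "i < length ps" for i using ps that by auto
  have eq: "map f ps ! i = map f ps ! j \<longleftrightarrow> map g ps ! i = map g ps ! j"
    if "i < length ps" "j < length ps" for i j
    using inj psK that by (auto simp: inj_on_eq_iff)
  have "map ((!) (map f ps)) is \<in> intp A s \<longleftrightarrow> map ((!) (map g ps)) is \<in> intp A s"
    if "sig A s = Some (length is)" "set is \<subseteq> {..<length ps}" for s "is"
  proof -
    have "map ((!) (map f ps)) is = map f (map ((!) ps) is)"
      "map ((!) (map g ps)) is = map g (map ((!) ps) is)"
      using that by (auto simp: subset_iff)
    moreover have "set (map ((!) ps) is) \<subseteq> univ K" using that psK by (auto simp: subset_iff)
    ultimately show ?thesis
      using embeddings_intp[OF f, of s "map ((!) ps) is"] embeddings_intp[OF g, of s "map ((!) ps) is"]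
        that sig by (simp del: map_map)
  qed
  with eq have "atomic_type (map f ps) = atomic_type (map g ps)"
    unfolding atomic_type_def by auto
  then show ?thesis using same_orbit_iff_atomic_type[OF fX] by simp
qed

lemma Aut_embedding: "g \<in> Aut A \<Longrightarrow> g \<in> embeddings A A"
  by (simp add: Aut_def isomorphisms_def)

end

lemma list_through_surjection:
  assumes "set xs \<subseteq> f ` S"
  obtains ps where "set ps \<subseteq> S" "map f ps = xs"
proof
  show "set (map (inv_into S f) xs) \<subseteq> S" using assms by (auto intro: inv_into_into)
  show "map f (map (inv_into S f) xs) = xs" unfolding map_map
    by (rule map_idI) (use assms in \<open>auto simp: f_inv_into_f\<close>)
qed

locale ramsey_structure = finitely_homogeneous_structure A
  for A :: "('s, 'a) struct" +
  assumes ramsey: "ramsey A"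
begin

text \<open>Embeddings of the substructure on \<open>t\<close> correspond to the tuples in the orbit of \<open>t\<close>, and
  embeddings of the substructure on \<open>F\<close> extend to automorphisms by homogeneity.\<close>
lemma ramsey_one_orbit:
  assumes t: "set t \<subseteq> X" and F: "finite F" "F \<subseteq> X"
  shows "\<exists>C. finite C \<and> C \<subseteq> X \<and> (\<forall>\<chi>::'a list \<Rightarrow> nat. (\<forall>s. \<chi> s < k) \<longrightarrow>
    (\<exists>v\<in>Aut A. v ` F \<subseteq> C \<and> (\<exists>c. \<forall>s. set s \<subseteq> F \<and> t \<sim> s \<longrightarrow> \<chi> (map v s) = c)))"
proof -
  obtain T \<iota>T where T: "T \<in> age A" "\<iota>T \<in> embeddings T A" "\<iota>T ` univ T = set t"
    using age_copy[of "set t"] t by auto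
  obtain H \<iota>H where H: "H \<in> age A" "\<iota>H \<in> embeddings H A" "\<iota>H ` univ H = F"
    using age_copy[of F] F by auto
  obtain D where D: "D \<in> age A" "partition_arrow D H T k"
    using ramsey T(1) H(1) unfolding ramsey_def by blast
  have sigs: "sig T = sig A" "sig H = sig A" "sig D = sig A" and finD: "finite (univ D)"
    using T(1) H(1) D(1) by (auto simp: age_def)
  obtain \<iota>D where \<iota>D: "\<iota>D \<in> embeddings D A" using D(1) by (auto simp: age_def)
  obtain ps where ps: "set ps \<subseteq> univ T" "map \<iota>T ps = t"
    by (rule list_through_surjection[of t \<iota>T "univ T"]) (use T in auto)
  have finH: "finite (univ H)" using H(1) by (auto simp: age_def)
  then obtain hs where hs: "set hs = univ H" using finite_list by blast
  show ?thesis
  proof (intro exI[of _ "\<iota>D ` univ D"] conjI allI impI)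
    show "finite (\<iota>D ` univ D)" using finD by simp
    show "\<iota>D ` univ D \<subseteq> X" using embeddings_closed[OF \<iota>D] by auto
    fix \<chi> :: "'a list \<Rightarrow> nat" assume \<chi>: "\<forall>s. \<chi> s < k"
    \<comment> \<open>Colours start at 1 in the partition arrow.\<close>
    define \<chi>' where "\<chi>' f = Suc (\<chi> (map \<iota>D (map f ps)))" for f
    have "\<chi>' \<in> embeddings T D \<rightarrow> {1..k}" using \<chi> by (auto simp: \<chi>'_def Suc_le_eq)
    then obtain e c where e: "e \<in> embeddings H D"
      and c: "\<And>f. f \<in> embeddings T H \<Longrightarrow> \<chi>' (compose (univ T) e f) = c"
      using D(2) unfolding partition_arrow_def by blast
    have "map \<iota>H hs \<sim> map (compose (univ H) \<iota>D e) hs"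
      using hs by (intro embeddings_same_orbit[OF H(2) embeddings_compose[OF e \<iota>D]]) (auto simp: sigs)
    then obtain v where v: "v \<in> Aut A" "\<And>p. p \<in> univ H \<Longrightarrow> \<iota>D (e p) = v (\<iota>H p)"
      unfolding same_orbit_def using hs by (auto simp: compose_def)
    have "v ` F \<subseteq> \<iota>D ` univ D"
      unfolding H(3)[symmetric] using v(2)[symmetric] embeddings_closed[OF e] by auto
    moreover have "\<chi> (map v s) = c - 1" if s: "set s \<subseteq> F" "t \<sim> s" for s
    proof -
      obtain g where g: "g \<in> Aut A" "s = map g t" using s(2) by (auto simp: same_orbit_def)
      have j: "compose (univ T) g \<iota>T \<in> embeddings T A"
        using embeddings_compose[OF T(2) Aut_embedding[OF g(1)]] sigs by simp
      have "compose (univ T) g \<iota>T ` univ T = set s"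
        unfolding g set_map T(3)[symmetric] by (auto simp: compose_def)
      then obtain f where f: "f \<in> embeddings T H" "\<And>p. p \<in> univ T \<Longrightarrow> \<iota>H (f p) = g (\<iota>T p)"
        using embeddings_factor[OF j H(2)] s(1) H(3) sigs by (auto simp: compose_def)
      have "\<iota>D (compose (univ T) e f p) = v (g (\<iota>T p))" if "p \<in> univ T" for p
        using v(2)[OF embeddings_closed[OF f(1) that]] f(2)[OF that] that by (simp add: compose_def)
      then have "map \<iota>D (map (compose (univ T) e f) ps) = map v s"
        unfolding g ps(2)[symmetric] using ps(1) by auto
      then show ?thesis using c[OF f(1)] unfolding \<chi>'_def by simp
    qed
    ultimately show "\<exists>v\<in>Aut A. v ` F \<subseteq> \<iota>D ` univ D \<and>
        (\<exists>c. \<forall>s. set s \<subseteq> F \<and> t \<sim> s \<longrightarrow> \<chi> (map v s) = c)"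
      using v(1) by blast
  qed
qed

text \<open>The orbits are treated one after the other. The set that works for the orbits before is taken as the set
  to be copied when the next orbit is added; composing the automorphisms preserves what was achieved for
  the earlier orbits.\<close>
lemma ramsey_finitely_many_orbits:
  assumes "finite T" "\<And>t. t \<in> T \<Longrightarrow> set t \<subseteq> X" and F: "finite F" "F \<subseteq> X"
  shows "\<exists>C. finite C \<and> C \<subseteq> X \<and> (\<forall>\<chi>::'a list \<Rightarrow> nat. (\<forall>s. \<chi> s < k) \<longrightarrow>
    (\<exists>v\<in>Aut A. v ` F \<subseteq> C \<and> (\<forall>t\<in>T. \<exists>c. \<forall>s. set s \<subseteq> F \<and> t \<sim> s \<longrightarrow> \<chi> (map v s) = c)))"
  using assms(1,2)
proof (induction T)
  case empty
  have "(\<lambda>x\<in>X. x) ` F \<subseteq> F" using F by auto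
  then have "\<exists>v\<in>Aut A. v ` F \<subseteq> F" using Aut_id by blast
  then show ?case using F by (intro exI[of _ F]) auto
next
  case (insert t T)
  have "\<exists>C. finite C \<and> C \<subseteq> X \<and> (\<forall>\<chi>::'a list \<Rightarrow> nat. (\<forall>s. \<chi> s < k) \<longrightarrow>
    (\<exists>v\<in>Aut A. v ` F \<subseteq> C \<and> (\<forall>t\<in>T. \<exists>c. \<forall>s. set s \<subseteq> F \<and> t \<sim> s \<longrightarrow> \<chi> (map v s) = c)))"
    by (rule insert.IH) (use insert.prems in simp)
  then obtain C where *: "finite C \<and> C \<subseteq> X \<and> (\<forall>\<chi>::'a list \<Rightarrow> nat. (\<forall>s. \<chi> s < k) \<longrightarrow>
    (\<exists>v\<in>Aut A. v ` F \<subseteq> C \<and> (\<forall>t\<in>T. \<exists>c. \<forall>s. set s \<subseteq> F \<and> t \<sim> s \<longrightarrow> \<chi> (map v s) = c)))"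
    by (rule exE)
  then have C: "finite C" "C \<subseteq> X" by simp_all
  note homC = *[THEN conjunct2, THEN conjunct2, THEN spec, THEN mp]
  obtain C' where *: "finite C' \<and> C' \<subseteq> X \<and> (\<forall>\<chi>::'a list \<Rightarrow> nat. (\<forall>s. \<chi> s < k) \<longrightarrow>
    (\<exists>v\<in>Aut A. v ` C \<subseteq> C' \<and> (\<exists>c. \<forall>s. set s \<subseteq> C \<and> t \<sim> s \<longrightarrow> \<chi> (map v s) = c)))"
    using ramsey_one_orbit[OF _ C, of t k] insert.prems by auto
  then have C': "finite C'" "C' \<subseteq> X" by simp_all
  note homC' = *[THEN conjunct2, THEN conjunct2, THEN spec, THEN mp]
  show ?case
  proof (intro exI[of _ C'] conjI allI impI C')
    fix \<chi> :: "'a list \<Rightarrow> nat" assume \<chi>: "\<forall>s. \<chi> s < k"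
    from homC'[OF \<chi>] obtain w c where w: "w \<in> Aut A" "w ` C \<subseteq> C'"
      "\<forall>s. set s \<subseteq> C \<and> t \<sim> s \<longrightarrow> \<chi> (map w s) = c"
      by (elim bexE exE conjE)
    obtain v where v: "v \<in> Aut A" "v ` F \<subseteq> C"
      "\<And>t. t \<in> T \<Longrightarrow> \<exists>c. \<forall>s. set s \<subseteq> F \<and> t \<sim> s \<longrightarrow> \<chi> (map w (map v s)) = c"
      using homC[of "\<lambda>s. \<chi> (map w s)"] \<chi> by auto
    have wv: "map (compose X w v) s = map w (map v s)" if "set s \<subseteq> F" for s
      using that F by (auto simp: compose_def)
    show "\<exists>v\<in>Aut A. v ` F \<subseteq> C' \<and>
        (\<forall>t\<in>insert t T. \<exists>c. \<forall>s. set s \<subseteq> F \<and> t \<sim> s \<longrightarrow> \<chi> (map v s) = c)"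
    proof (intro bexI[of _ "compose X w v"] conjI ballI)
      show "compose X w v \<in> Aut A" by (rule Aut_compose[OF w(1) v(1)])
      show "compose X w v ` F \<subseteq> C'" using w(2) v(2) F by (auto simp: compose_def)
      fix t' assume "t' \<in> insert t T"
      then consider "t' = t" | "t' \<in> T" by blast
      then show "\<exists>c. \<forall>s. set s \<subseteq> F \<and> t' \<sim> s \<longrightarrow> \<chi> (map (compose X w v) s) = c"
      proof cases
        case 1
        have "\<chi> (map (compose X w v) s) = c" if s: "set s \<subseteq> F" "t \<sim> s" for s
        proof -
          have "t \<sim> map v s"
            using same_orbit_trans[OF s(2) same_orbit_map[OF v(1)]] insert.prems by auto
          moreover have "set (map v s) \<subseteq> C" using s v(2) by auto
          ultimately show ?thesis unfolding wv[OF s(1)] using w(3) by blast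
        qed
        then show ?thesis using 1 by blast
      next
        case 2
        then obtain c where "\<forall>s. set s \<subseteq> F \<and> t' \<sim> s \<longrightarrow> \<chi> (map w (map v s)) = c"
          using v(3) by blast
        then show ?thesis using wv by metis
      qed
    qed
  qed
qed

lemma ramsey_tuples:
  assumes F: "finite F" "F \<subseteq> X" and K: "finite K"
  shows "\<exists>C. finite C \<and> C \<subseteq> X \<and> (\<forall>\<chi>::'a list \<Rightarrow> 'k. range \<chi> \<subseteq> K \<longrightarrow>
    (\<exists>v\<in>Aut A. v ` F \<subseteq> C \<and> (\<forall>t s. set t \<subseteq> F \<and> set s \<subseteq> F \<and> length t \<le> L \<and> t \<sim> s \<longrightarrow>
      \<chi> (map v t) = \<chi> (map v s))))"
proof -
  obtain h and k :: nat where h: "h ` K = {i. i < k}" "inj_on h K"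
    using finite_imp_inj_to_nat_seg[OF K] by blast
  define T where "T = {t. set t \<subseteq> F \<and> length t \<le> L}"
  have "finite T" unfolding T_def by (rule finite_lists_length_le[OF F(1)])
  moreover have "set t \<subseteq> X" if "t \<in> T" for t using that F by (auto simp: T_def)
  ultimately have "\<exists>C. finite C \<and> C \<subseteq> X \<and> (\<forall>\<chi>::'a list \<Rightarrow> nat. (\<forall>s. \<chi> s < k) \<longrightarrow>
    (\<exists>v\<in>Aut A. v ` F \<subseteq> C \<and> (\<forall>t\<in>T. \<exists>c. \<forall>s. set s \<subseteq> F \<and> t \<sim> s \<longrightarrow> \<chi> (map v s) = c)))"
    using F by (rule ramsey_finitely_many_orbits)
  then obtain C where *: "finite C \<and> C \<subseteq> X \<and> (\<forall>\<chi>::'a list \<Rightarrow> nat. (\<forall>s. \<chi> s < k) \<longrightarrow>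
    (\<exists>v\<in>Aut A. v ` F \<subseteq> C \<and> (\<forall>t\<in>T. \<exists>c. \<forall>s. set s \<subseteq> F \<and> t \<sim> s \<longrightarrow> \<chi> (map v s) = c)))"
    by (rule exE)
  then have C: "finite C" "C \<subseteq> X" by simp_all
  note homC = *[THEN conjunct2, THEN conjunct2, THEN spec, THEN mp]
  show ?thesis
  proof (intro exI[of _ C] conjI allI impI C)
    fix \<chi> :: "'a list \<Rightarrow> 'k" assume \<chi>: "range \<chi> \<subseteq> K"
    then have \<chi>K: "\<chi> s \<in> K" for s by auto
    have "\<forall>s. h (\<chi> s) < k" using h(1) \<chi>K by blast
    then obtain v where v: "v \<in> Aut A" "v ` F \<subseteq> C"
      "\<And>t. t \<in> T \<Longrightarrow> \<exists>c. \<forall>s. set s \<subseteq> F \<and> t \<sim> s \<longrightarrow> h (\<chi> (map v s)) = c"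
      using homC[of "\<lambda>s. h (\<chi> s)"] by auto
    have "\<chi> (map v t) = \<chi> (map v s)" if "set t \<subseteq> F" "set s \<subseteq> F" "length t \<le> L" "t \<sim> s" for t s
    proof -
      have "h (\<chi> (map v t)) = h (\<chi> (map v s))"
        using v(3)[of t] that same_orbit_refl[of t] F by (auto simp: T_def)
      then show ?thesis using h(2) \<chi>K by (auto dest: inj_onD)
    qed
    then show "\<exists>v\<in>Aut A. v ` F \<subseteq> C \<and> (\<forall>t s. set t \<subseteq> F \<and> set s \<subseteq> F \<and> length t \<le> L \<and> t \<sim> s \<longrightarrow>
      \<chi> (map v t) = \<chi> (map v s))" using v(1,2) by blast
  qed
qed

text \<open>Induction on the number of factors. Let \<open>C\<close> be a finite set for the last \<open>n\<close> factors. A tuple in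
  the first factor is coloured by the whole function that maps the tuples over \<open>C\<close> in the
  other factors to their colours. This finite colouring determines the automorphism \<open>v\<close> for the first
  factor. The other factors are then coloured by the function that records the colour for every
  tuple over \<open>v ` F\<close> in the first factor. For this to work, \<open>C\<close> must not depend on the
  colouring, which is why a finite set \<open>C\<close> occurs in the statement.\<close>
lemma ramsey_product_lists:
  assumes F: "finite F" "F \<subseteq> X"
  shows "\<exists>C. finite C \<and> C \<subseteq> X \<and> (\<forall>\<chi>::'a list list \<Rightarrow> nat. (\<forall>ts. \<chi> ts < k) \<longrightarrow>
    (\<exists>vs. length vs = n \<and> (\<forall>v\<in>set vs. v \<in> Aut A \<and> v ` F \<subseteq> C) \<and>
      (\<forall>ts ss. length ts = n \<and>
          list_all2 (\<lambda>t s. set t \<subseteq> F \<and> set s \<subseteq> F \<and> length t \<le> L \<and> t \<sim> s) ts ss \<longrightarrow>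
        \<chi> (map2 map vs ts) = \<chi> (map2 map vs ss))))"
proof (induction n arbitrary: k)
  case 0
  show ?case by (intro exI[of _ "{}"]) auto
next
  case (Suc n)
  let ?good = "\<lambda>t s. set t \<subseteq> F \<and> set s \<subseteq> F \<and> length t \<le> L \<and> t \<sim> s"
  define TF where "TF = {t. set t \<subseteq> F \<and> length t \<le> L}"
  have "finite TF" unfolding TF_def by (rule finite_lists_length_le[OF F(1)])
  then have "finite (TF \<rightarrow>\<^sub>E {..<k})" by (intro finite_PiE) auto
  from finite_imp_inj_to_nat_seg[OF this] obtain h and k1 :: nat
    where h: "h ` (TF \<rightarrow>\<^sub>E {..<k}) = {i. i < k1}" "inj_on h (TF \<rightarrow>\<^sub>E {..<k})"
    by (elim exE conjE)
  obtain C where *: "finite C \<and> C \<subseteq> X \<and> (\<forall>\<chi>::'a list list \<Rightarrow> nat. (\<forall>ts. \<chi> ts < k1) \<longrightarrow>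
    (\<exists>vs. length vs = n \<and> (\<forall>v\<in>set vs. v \<in> Aut A \<and> v ` F \<subseteq> C) \<and>
      (\<forall>ts ss. length ts = n \<and> list_all2 ?good ts ss \<longrightarrow>
        \<chi> (map2 map vs ts) = \<chi> (map2 map vs ss))))"
    using Suc.IH[of k1] by (rule exE)
  then have C: "finite C" "C \<subseteq> X" by simp_all
  note homC = *[THEN conjunct2, THEN conjunct2, THEN spec, THEN mp]
  define TC where "TC = {ts. set ts \<subseteq> {t. set t \<subseteq> C \<and> length t \<le> L} \<and> length ts = n}"
  have "finite TC" unfolding TC_def by (intro finite_lists_length_eq finite_lists_length_le C(1))
  then have "finite (TC \<rightarrow>\<^sub>E {..<k})" by (intro finite_PiE) auto
  from ramsey_tuples[OF F this, of L]
  obtain C' where *: "finite C' \<and> C' \<subseteq> X \<and>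
    (\<forall>\<chi>::'a list \<Rightarrow> 'a list list \<Rightarrow> nat. range \<chi> \<subseteq> (TC \<rightarrow>\<^sub>E {..<k}) \<longrightarrow>
    (\<exists>v\<in>Aut A. v ` F \<subseteq> C' \<and> (\<forall>t s. ?good t s \<longrightarrow> \<chi> (map v t) = \<chi> (map v s))))"
    by (rule exE)
  then have C': "finite C'" "C' \<subseteq> X" by simp_all
  note homC' = *[THEN conjunct2, THEN conjunct2, THEN spec, THEN mp]
  show ?case
  proof (intro exI[of _ "C \<union> C'"] conjI allI impI)
    show "finite (C \<union> C')" "C \<union> C' \<subseteq> X" using C C' by auto
    fix \<chi> :: "'a list list \<Rightarrow> nat" assume \<chi>: "\<forall>ts. \<chi> ts < k"
    have "range (\<lambda>t. \<lambda>ts\<in>TC. \<chi> (t # ts)) \<subseteq> (TC \<rightarrow>\<^sub>E {..<k})" using \<chi> by auto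
    then obtain v where v: "v \<in> Aut A" "v ` F \<subseteq> C'" "\<And>t s. ?good t s \<Longrightarrow>
        (\<lambda>ts\<in>TC. \<chi> (map v t # ts)) = (\<lambda>ts\<in>TC. \<chi> (map v s # ts))"
      using homC'[of "\<lambda>t. \<lambda>ts\<in>TC. \<chi> (t # ts)"] by auto
    define \<chi>1 where "\<chi>1 ts = (\<lambda>t\<in>TF. \<chi> (map v t # ts))" for ts
    have \<chi>1: "\<chi>1 ts \<in> TF \<rightarrow>\<^sub>E {..<k}" for ts using \<chi> by (auto simp: \<chi>1_def)
    then have "\<forall>ts. h (\<chi>1 ts) < k1" using h(1) by blast
    then obtain vs where vs: "length vs = n" "\<And>w. w \<in> set vs \<Longrightarrow> w \<in> Aut A \<and> w ` F \<subseteq> C"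
      "\<And>ts ss. length ts = n \<Longrightarrow> list_all2 ?good ts ss \<Longrightarrow>
        h (\<chi>1 (map2 map vs ts)) = h (\<chi>1 (map2 map vs ss))"
      using homC[of "\<lambda>ts. h (\<chi>1 ts)"] by auto
    show "\<exists>vs. length vs = Suc n \<and> (\<forall>v\<in>set vs. v \<in> Aut A \<and> v ` F \<subseteq> C \<union> C') \<and>
      (\<forall>ts ss. length ts = Suc n \<and> list_all2 ?good ts ss \<longrightarrow>
        \<chi> (map2 map vs ts) = \<chi> (map2 map vs ss))"
    proof (intro exI[of _ "v # vs"] conjI allI impI)
      show "length (v # vs) = Suc n" using vs(1) by simp
      show "\<forall>v\<in>set (v # vs). v \<in> Aut A \<and> v ` F \<subseteq> C \<union> C'" using v(1,2) vs(2) by fastforce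
      fix ts ss assume *: "length ts = Suc n \<and> list_all2 ?good ts ss"
      then obtain t ts' where ts: "ts = t # ts'" by (cases ts) auto
      then obtain s ss' where ss: "ss = s # ss'" using * by (cases ss) auto
      have good: "?good t s" "list_all2 ?good ts' ss'" "length ts' = n" using * by (simp_all add: ts ss)
      have len: "length ss' = n" using good(2,3) list_all2_lengthD by force
      have "\<chi>1 (map2 map vs ts') = \<chi>1 (map2 map vs ss')"
        using vs(3)[OF good(3,2)] h(2) \<chi>1 by (auto dest: inj_onD)
      moreover have "t \<in> TF" using good(1) by (simp add: TF_def)
      ultimately have 1: "\<chi> (map v t # map2 map vs ts') = \<chi> (map v t # map2 map vs ss')"
        unfolding \<chi>1_def by (metis (no_types, lifting) restrict_apply')
      have "map2 map vs ss' \<in> TC"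
      proof -
        have "set (map w s') \<subseteq> C \<and> length (map w s') \<le> L" if "(w, s') \<in> set (zip vs ss')" for w s'
        proof -
          have w: "w ` F \<subseteq> C" and "s' \<in> set ss'" using vs(2) that by (auto dest: set_zip_leftD set_zip_rightD)
          then obtain i where "i < length ss'" "s' = ss' ! i" by (auto simp: in_set_conv_nth)
          then have "?good (ts' ! i) s'" using good(2) by (simp add: list_all2_conv_all_nth)
          then show ?thesis using w same_orbit_length by force
        qed
        then show ?thesis using vs(1) len unfolding TC_def by fastforce
      qed
      then have "\<chi> (map v t # map2 map vs ss') = \<chi> (map v s # map2 map vs ss')"
        using v(3)[OF good(1)] by (metis (no_types, lifting) restrict_apply')
      with 1 show "\<chi> (map2 map (v # vs) ts) = \<chi> (map2 map (v # vs) ss)"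
        by (simp add: ts ss)
    qed
  qed
qed

lemma ramsey_product:
  fixes \<chi> :: "'a list list \<Rightarrow> 'k"
  assumes F: "finite F" "F \<subseteq> X" and \<chi>: "finite (range \<chi>)"
  shows "\<exists>v. (\<forall>i<n. v i \<in> Aut A) \<and>
    (\<forall>ts ss. length ts = n \<and> length ss = n \<and>
        (\<forall>i<n. set (ts ! i) \<subseteq> F \<and> set (ss ! i) \<subseteq> F \<and> length (ts ! i) \<le> L \<and> ts ! i \<sim> ss ! i) \<longrightarrow>
      \<chi> (map (\<lambda>i. map (v i) (ts ! i)) [0..<n]) = \<chi> (map (\<lambda>i. map (v i) (ss ! i)) [0..<n]))"
proof -
  obtain h and k :: nat where h: "h ` range \<chi> = {i. i < k}" "inj_on h (range \<chi>)"
    using finite_imp_inj_to_nat_seg[OF \<chi>] by blast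
  then have "\<forall>ts. h (\<chi> ts) < k" by blast
  then obtain vs where vs: "length vs = n" "\<And>v. v \<in> set vs \<Longrightarrow> v \<in> Aut A"
    and hom: "\<And>ts ss. length ts = n \<and>
          list_all2 (\<lambda>t s. set t \<subseteq> F \<and> set s \<subseteq> F \<and> length t \<le> L \<and> t \<sim> s) ts ss \<Longrightarrow>
        h (\<chi> (map2 map vs ts)) = h (\<chi> (map2 map vs ss))"
    using ramsey_product_lists[OF F, of k n L] by (elim exE conjE allE[of _ "\<lambda>ts. h (\<chi> ts)"]) auto
  have map2: "map2 map vs ts = map (\<lambda>i. map (vs ! i) (ts ! i)) [0..<n]" if "length ts = n" for ts
    using that vs(1) by (intro nth_equalityI) auto
  show ?thesis
  proof (intro exI[of _ "(!) vs"] conjI allI impI)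
    show "vs ! i \<in> Aut A" if "i < n" for i using vs that by auto
    fix ts ss
    assume *: "length ts = n \<and> length ss = n \<and>
        (\<forall>i<n. set (ts ! i) \<subseteq> F \<and> set (ss ! i) \<subseteq> F \<and> length (ts ! i) \<le> L \<and> ts ! i \<sim> ss ! i)"
    then have "h (\<chi> (map2 map vs ts)) = h (\<chi> (map2 map vs ss))"
      by (intro hom) (simp add: list_all2_conv_all_nth)
    then have "\<chi> (map2 map vs ts) = \<chi> (map2 map vs ss)" using h(2) by (auto dest: inj_onD)
    then show "\<chi> (map (\<lambda>i. map (vs ! i) (ts ! i)) [0..<n]) = \<chi> (map (\<lambda>i. map (vs ! i) (ss ! i)) [0..<n])"
      using * map2 by simp
  qed
qed

section \<open>Independent copies\<close>

definition independent :: "('a \<Rightarrow> 'a) \<Rightarrow> ('a \<Rightarrow> 'a) \<Rightarrow> bool" where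
  "independent \<rho> \<sigma> \<longleftrightarrow> orbit_preserving \<rho> \<and> orbit_preserving \<sigma> \<and>
    (\<forall>a b a' b'. set a \<subseteq> X \<and> set b \<subseteq> X \<and> a \<sim> a' \<and> b \<sim> b' \<longrightarrow>
       map \<rho> a @ map \<sigma> b \<sim> map \<rho> a' @ map \<sigma> b')"

text \<open>For a finite set this is the product Ramsey property for two factors, where a pair of tuples is
  coloured by the orbit of their concatenation. A limit over larger and larger finite sets gives maps
  on the whole domain.\<close>
lemma independent_copies: "\<exists>\<rho> \<sigma>. independent \<rho> \<sigma>"
proof -
  \<comment> \<open>The bounds on the tuples make the number of colours finite.\<close>
  define \<chi> where "\<chi> l ts = atomic_type
    (if set (concat ts) \<subseteq> X \<and> length (concat ts) \<le> l + l then concat ts else [])" for l and ts :: "'a list list"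
  have \<chi>: "finite (range (\<chi> l))" for l
    by (rule finite_subset[OF _ finite_atomic_types[of "l + l"]]) (auto simp: \<chi>_def)
  let ?Q = "\<lambda>l v. (\<forall>i<2. v i \<in> Aut A) \<and>
    (\<forall>ts ss. length ts = 2 \<and> length ss = 2 \<and>
        (\<forall>i<2. set (ts ! i) \<subseteq> segment l \<and> set (ss ! i) \<subseteq> segment l \<and> length (ts ! i) \<le> l \<and> ts ! i \<sim> ss ! i) \<longrightarrow>
      \<chi> l (map (\<lambda>i. map (v i) (ts ! i)) [0..<2]) = \<chi> l (map (\<lambda>i. map (v i) (ss ! i)) [0..<2]))"
  have "\<forall>l. \<exists>v. ?Q l v"
    by (intro allI ramsey_product finite_segment segment_subset \<chi>)
  then obtain v where Q: "\<forall>l. ?Q l (v l)" by (rule choice[THEN exE])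
  have v: "v l i \<in> Aut A" if "i < 2" for l i using Q that by simp
  note hom = Q[THEN spec, THEN conjunct2, THEN spec, THEN spec, THEN mp]
  have indep: "map (v l 0) a @ map (v l 1) b \<sim> map (v l 0) a' @ map (v l 1) b'"
    if F: "set a \<subseteq> segment l" "set b \<subseteq> segment l" "set a' \<subseteq> segment l" "set b' \<subseteq> segment l"
      and L: "length a \<le> l" "length b \<le> l" and o: "a \<sim> a'" "b \<sim> b'" for l a b a' b'
  proof -
    have 2: "i < 2 \<longleftrightarrow> i = 0 \<or> i = 1" for i :: nat by auto
    have "\<chi> l (map (\<lambda>i. map (v l i) ([a, b] ! i)) [0..<2]) = \<chi> l (map (\<lambda>i. map (v l i) ([a', b'] ! i)) [0..<2])"
      by (rule hom) (use that in \<open>auto simp: 2\<close>)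
    then have eq: "\<chi> l [map (v l 0) a, map (v l 1) b] = \<chi> l [map (v l 0) a', map (v l 1) b']"
      by (simp add: upt_rec)
    have sub: "set (map (v l i) c) \<subseteq> X" if "i < 2" "set c \<subseteq> segment l" for i c
      using Aut_closed[OF v[OF that(1)]] that segment_subset[of l] by auto
    have "set (map (v l 0) a @ map (v l 1) b) \<subseteq> X" "set (map (v l 0) a' @ map (v l 1) b') \<subseteq> X"
      using sub[of 0 a] sub[of 1 b] sub[of 0 a'] sub[of 1 b'] F by auto
    moreover have "length a' = length a" "length b' = length b" using o by (auto dest: same_orbit_length)
    ultimately show ?thesis
      using eq L by (subst same_orbit_iff_atomic_type) (auto simp: \<chi>_def)
  qed
  define \<phi> where "\<phi> l xb = v l (if snd xb then 1 else 0) (fst xb)" for l and xb :: "'a \<times> bool"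
  have "countable (X \<times> (UNIV :: bool set))" using countable_univ by (intro countable_SIGMA) auto
  moreover have "\<phi> l xb \<in> X" if "xb \<in> X \<times> UNIV" for l xb
    using that Aut_closed[OF v] by (auto simp: \<phi>_def)
  ultimately obtain \<psi> where \<psi>: "\<And>P. finite P \<and> P \<subseteq> X \<times> UNIV \<Longrightarrow>
      infinite {l \<in> UNIV. conjugate_on P (\<phi> l) \<psi>}"
    using limit_up_to_conjugation[of "X \<times> (UNIV :: bool set)" UNIV \<phi>] by (auto simp del: Collect_const)
  define \<rho> where "\<rho> x = \<psi> (x, False)" for x
  define \<sigma> where "\<sigma> x = \<psi> (x, True)" for x
  have lim: "\<exists>l\<ge>N. \<forall>a b. set a \<subseteq> P \<and> set b \<subseteq> P \<longrightarrow>
      map (v l 0) a @ map (v l 1) b \<sim> map \<rho> a @ map \<sigma> b"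
    if "finite P" "P \<subseteq> X" for P N
  proof -
    have "infinite {l \<in> UNIV. conjugate_on (P \<times> UNIV) (\<phi> l) \<psi>}" using that by (intro \<psi>) auto
    then obtain l where l: "l \<ge> N" "conjugate_on (P \<times> UNIV) (\<phi> l) \<psi>"
      unfolding infinite_nat_iff_unbounded_le by auto
    have "map (v l 0) a @ map (v l 1) b \<sim> map \<rho> a @ map \<sigma> b" if "set a \<subseteq> P" "set b \<subseteq> P" for a b
    proof -
      have "conjugate_on (set (map (\<lambda>x. (x, False)) a @ map (\<lambda>x. (x, True)) b)) (\<phi> l) \<psi>"
        using l(2) that by (elim conjugate_on_mono) auto
      then show ?thesis
        unfolding conjugate_on_set by (simp add: \<phi>_def \<rho>_def[abs_def] \<sigma>_def[abs_def] comp_def)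
    qed
    with l(1) show ?thesis by blast
  qed
  have \<rho>: "orbit_preserving \<rho>" unfolding orbit_preserving_def
  proof (intro allI impI)
    fix a assume a: "set a \<subseteq> X"
    then obtain l where "map (v l 0) a @ map (v l 1) [] \<sim> map \<rho> a @ map \<sigma> []"
      using lim[of "set a"] by (metis List.finite_set empty_set empty_subsetI order_refl)
    then have "map (v l 0) a \<sim> map \<rho> a" by simp
    then show "a \<sim> map \<rho> a" by (rule same_orbit_trans[OF same_orbit_map[OF v[of 0 l]] _ a, rotated]) simp
  qed
  have \<sigma>: "orbit_preserving \<sigma>" unfolding orbit_preserving_def
  proof (intro allI impI)
    fix b assume b: "set b \<subseteq> X"
    then obtain l where "map (v l 0) [] @ map (v l 1) b \<sim> map \<rho> [] @ map \<sigma> b"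
      using lim[of "set b"] by (metis List.finite_set empty_set empty_subsetI order_refl)
    then have "map (v l 1) b \<sim> map \<sigma> b" by simp
    then show "b \<sim> map \<sigma> b" by (rule same_orbit_trans[OF same_orbit_map[OF v[of 1 l]] _ b, rotated]) simp
  qed
  have "map \<rho> a @ map \<sigma> b \<sim> map \<rho> a' @ map \<sigma> b'"
    if ab: "set a \<subseteq> X" "set b \<subseteq> X" "a \<sim> a'" "b \<sim> b'" for a b a' b'
  proof -
    have ab': "set a' \<subseteq> X" "set b' \<subseteq> X" using ab same_orbit_closed by blast+
    define P where "P = set a \<union> set b \<union> set a' \<union> set b'"
    have P: "finite P" "P \<subseteq> X" using ab ab' by (auto simp: P_def)
    obtain N where N: "P \<subseteq> segment N" using segments_exhaust[OF P] by blast
    obtain l where l: "l \<ge> max N (max (length a) (length b))" and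
      conj: "\<And>a b. set a \<subseteq> P \<Longrightarrow> set b \<subseteq> P \<Longrightarrow> map (v l 0) a @ map (v l 1) b \<sim> map \<rho> a @ map \<sigma> b"
      using lim[OF P] by blast
    have PF: "P \<subseteq> segment l" using N l segment_mono[of N l] by auto
    have vX: "set (map (v l 0) c @ map (v l 1) d) \<subseteq> X" if "set c \<subseteq> P" "set d \<subseteq> P" for c d
      using that P Aut_closed[OF v[of 0 l]] Aut_closed[OF v[of 1 l]] by auto
    have 1: "map (v l 0) a @ map (v l 1) b \<sim> map \<rho> a @ map \<sigma> b"
      by (rule conj) (auto simp: P_def)
    have 2: "map (v l 0) a' @ map (v l 1) b' \<sim> map \<rho> a' @ map \<sigma> b'"
      by (rule conj) (auto simp: P_def)
    have 3: "map (v l 0) a @ map (v l 1) b \<sim> map (v l 0) a' @ map (v l 1) b'"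
      by (rule indep) (use PF l ab in \<open>auto simp: P_def\<close>)
    have vab: "set (map (v l 0) a @ map (v l 1) b) \<subseteq> X" by (rule vX) (auto simp: P_def)
    have 4: "map \<rho> a @ map \<sigma> b \<sim> map (v l 0) a @ map (v l 1) b"
      by (rule same_orbit_sym[OF 1 vab])
    have "map (v l 0) a @ map (v l 1) b \<sim> map \<rho> a' @ map \<sigma> b'"
      by (rule same_orbit_trans[OF 3 2 vab])
    then show ?thesis
      using same_orbit_trans[OF 4] same_orbit_closed[OF 1 vab] by blast
  qed
  then have "independent \<rho> \<sigma>" unfolding independent_def using \<rho> \<sigma> by blast
  then show ?thesis by blast
qed

end

context finitely_homogeneous_structure
begin

section \<open>Canonical operations\<close>

text \<open>The columns of the matrix \<open>as\<close> are the entries of the list; its row \<open>j\<close> is what an operation is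
  applied to in order to get the entry \<open>j\<close> of the componentwise value.\<close>

definition row :: "'a list list \<Rightarrow> nat \<Rightarrow> 'a list" where
  "row as j = map (\<lambda>a. a ! j) as"

lemma apply_componentwise_rows: "apply_componentwise f r as = map (\<lambda>j. fn f (row as j)) [0..<r]"
  by (simp add: apply_componentwise_def row_def)

lemma row_in_tuples: "as \<in> tuples (tuples S r) n \<Longrightarrow> j < r \<Longrightarrow> row as j \<in> tuples S n"
  by (auto simp: row_def tuples_iff subset_iff)

lemma apply_componentwise_conjugate:
  assumes "conjugate_on P (fn f) (fn g)" "\<And>j. j < r \<Longrightarrow> row as j \<in> P"
  shows "apply_componentwise f r as \<sim> apply_componentwise g r as"
proof -
  have "conjugate_on (set (map (row as) [0..<r])) (fn f) (fn g)"
    using assms(1) by (rule conjugate_on_mono) (use assms(2) in auto)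
  then show ?thesis unfolding conjugate_on_set by (simp add: apply_componentwise_rows comp_def)
qed

lemma apply_componentwise_twist:
  assumes as: "as \<in> tuples (tuples X r) (arity f)"
  shows "apply_componentwise (twist f v) r as =
    apply_componentwise f r (map (\<lambda>i. map (v i) (as ! i)) [0..<arity f])"
proof -
  have "fn (twist f v) (row as j) = fn f (row (map (\<lambda>i. map (v i) (as ! i)) [0..<arity f]) j)"
    if j: "j < r" for j
  proof -
    have "length (as ! i) = r" if "i < arity f" for i
      using nth_in_tuples[OF as that] by (simp add: tuples_iff)
    then have "map (\<lambda>i. v i (row as j ! i)) [0..<arity f] =
        row (map (\<lambda>i. map (v i) (as ! i)) [0..<arity f]) j"
      using as j by (auto simp: row_def tuples_iff[of _ _ "arity f"])
    then show ?thesis using fn_twist[OF row_in_tuples[OF as j]] by simp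
  qed
  then show ?thesis by (simp add: apply_componentwise_rows)
qed

lemma Can_operations: "f \<in> Can A \<Longrightarrow> f \<in> operations X"
  by (simp add: Can_def)

lemma canonical_same_orbit:
  assumes "f \<in> Can A" "as \<in> tuples (tuples X r) (arity f)" "bs \<in> tuples (tuples X r) (arity f)"
    "\<And>i. i < arity f \<Longrightarrow> as ! i \<sim> bs ! i"
  shows "apply_componentwise f r as \<sim> apply_componentwise f r bs"
  using assms canonical_iff[of f] by (simp add: Can_def)

lemma finite_set_of_short_types:
  "\<exists>S. finite S \<and> S \<subseteq> X \<and> (\<forall>t. set t \<subseteq> X \<and> length t \<le> q \<longrightarrow> (\<exists>s. set s \<subseteq> S \<and> t \<sim> s))"
proof -
  let ?T = "{t. set t \<subseteq> X \<and> length t \<le> q}"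
  obtain R where R: "R \<subseteq> ?T" "finite R" "atomic_type ` ?T = atomic_type ` R"
    using finite_subset_image[OF finite_atomic_types[of q] order_refl] by blast
  have "\<exists>s. set s \<subseteq> \<Union> (set ` R) \<and> t \<sim> s" if "set t \<subseteq> X" "length t \<le> q" for t
  proof -
    have "atomic_type t \<in> atomic_type ` R" using that R(3) by blast
    then obtain s where "s \<in> R" "atomic_type t = atomic_type s" by blast
    then show ?thesis using same_orbit_iff_atomic_type[of t s] that R(1) by blast
  qed
  then show ?thesis using R(1,2) by (intro exI[of _ "\<Union> (set ` R)"]) auto
qed

text \<open>It suffices that \<open>S\<close> contains a representative of every orbit of tuples up to the length that determines orbits: by canonicity,
  the value on arguments outside of \<open>S\<close> has the same orbit as the value on arguments from \<open>S\<close>. Since \<open>S\<close>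
  is finite, canonical operations of a fixed arity fall into finitely many classes up to
  conjugation on finite sets.\<close>
lemma canonical_determined_on_finite_set:
  "\<exists>S. finite S \<and> S \<subseteq> X \<and> (\<forall>c\<in>Can A. \<forall>d\<in>Can A. arity c = m \<and> arity d = m \<and>
      conjugate_on (tuples S m) (fn c) (fn d) \<longrightarrow>
    (\<forall>F. finite F \<and> F \<subseteq> X \<longrightarrow> conjugate_on (tuples F m) (fn c) (fn d)))"
proof -
  obtain q where q: "\<forall>xs ys. set xs \<subseteq> X \<longrightarrow> set ys \<subseteq> X \<longrightarrow> length xs = length ys \<longrightarrow>
     (\<forall>is. set is \<subseteq> {..<length xs} \<and> length is \<le> q \<longrightarrow> map ((!) xs) is \<sim> map ((!) ys) is) \<longrightarrow> xs \<sim> ys"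
    using same_orbit_if_short_subtuples by (rule exE)
  obtain S where S: "finite S" "S \<subseteq> X"
    "\<And>t. set t \<subseteq> X \<Longrightarrow> length t \<le> q \<Longrightarrow> \<exists>s. set s \<subseteq> S \<and> t \<sim> s"
    using finite_set_of_short_types[of q] by auto
  show ?thesis
  proof (intro exI[of _ S] conjI S(1,2) ballI allI impI)
    fix c d F
    assume c: "c \<in> Can A" and d: "d \<in> Can A"
      and cd: "arity c = m \<and> arity d = m \<and> conjugate_on (tuples S m) (fn c) (fn d)"
      and F: "finite F \<and> F \<subseteq> X"
    have m: "arity c = m" "arity d = m" using cd by auto
    obtain ps where ps: "set ps = tuples F m" using finite_list[OF finite_tuples[of F m]] F by auto
    have sub: "tuples F m \<subseteq> tuples X m" using F by (intro tuples_mono) auto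
    have cX: "fn c x \<in> X" and dX: "fn d x \<in> X" if "x \<in> tuples X m" for x
      using operations_closed[OF Can_operations] c d m that by auto
    have "map (fn c) ps \<sim> map (fn d) ps"
    proof (rule q[rule_format])
      show "set (map (fn c) ps) \<subseteq> X" "set (map (fn d) ps) \<subseteq> X" using ps sub cX dX by auto
      fix "is" assume "set is \<subseteq> {..<length (map (fn c) ps)} \<and> length is \<le> q"
      then have "is": "set is \<subseteq> {..<length ps}" "length is \<le> q" by auto
      define r where "r = length is"
      define as where "as = map (\<lambda>i. map (\<lambda>j. ps ! (is ! j) ! i) [0..<r]) [0..<m]"
      have psj: "ps ! (is ! j) \<in> tuples X m" if "j < r" for j
      proof -
        have "is ! j < length ps" using that "is"(1) by (auto simp: r_def dest: nth_mem)
        then show ?thesis using ps sub nth_mem by blast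
      qed
      have as: "as \<in> tuples (tuples X r) m"
        unfolding as_def using nth_in_tuples[OF psj] by (intro map_indices_in_tuples) auto
      have row: "row as j = ps ! (is ! j)" if "j < r" for j
        using psj[OF that] that by (intro nth_equalityI) (auto simp: row_def as_def tuples_iff)
      have app: "apply_componentwise f r as = map ((!) (map (fn f) ps)) is" for f :: "'a operation"
        unfolding apply_componentwise_rows
        using "is"(1) row by (intro nth_equalityI) (auto simp: r_def subset_iff)
      have "\<exists>s. set s \<subseteq> S \<and> as ! i \<sim> s" if "i < m" for i
        using S(3)[of "as ! i"] nth_in_tuples[OF as that] "is"(2) by (auto simp: tuples_iff r_def)
      then obtain \<beta> where \<beta>: "\<And>i. i < m \<Longrightarrow> set (\<beta> i) \<subseteq> S \<and> as ! i \<sim> \<beta> i" by metis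
      define bs where "bs = map \<beta> [0..<m]"
      have "\<beta> i \<in> tuples S r" if "i < m" for i
        using \<beta>[OF that] nth_in_tuples[OF as that] same_orbit_length[of "as ! i" "\<beta> i"]
        by (auto simp: tuples_iff)
      then have bsS: "bs \<in> tuples (tuples S r) m"
        unfolding bs_def by (intro map_indices_in_tuples)
      then have bs: "bs \<in> tuples (tuples X r) m" using tuples_mono[OF tuples_mono[OF S(2)]] by blast
      have "as ! i \<sim> bs ! i" if "i < m" for i using \<beta> that by (simp add: bs_def)
      then have 1: "apply_componentwise c r as \<sim> apply_componentwise c r bs"
        and 2: "apply_componentwise d r as \<sim> apply_componentwise d r bs"
        using canonical_same_orbit c d m as bs by auto
      have 3: "apply_componentwise c r bs \<sim> apply_componentwise d r bs"
        using cd row_in_tuples[OF bsS] by (intro apply_componentwise_conjugate) auto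
      have "set (apply_componentwise c r as) \<subseteq> X" "set (apply_componentwise d r as) \<subseteq> X"
        using apply_componentwise_tuples[OF Can_operations] c d as m by (auto simp: tuples_iff)
      then have "apply_componentwise c r as \<sim> apply_componentwise d r as"
        using same_orbit_trans[OF 1 3] same_orbit_sym[OF 2] same_orbit_trans by blast
      then show "map ((!) (map (fn c) ps)) is \<sim> map ((!) (map (fn d) ps)) is"
        by (simp add: app)
    qed simp
    then show "conjugate_on (tuples F m) (fn c) (fn d)"
      unfolding ps[symmetric] conjugate_on_set .
  qed
qed

lemma fn_twist_minor:
  assumes "\<And>j. j < k \<Longrightarrow> orbit_preserving (v j)" "\<alpha> \<in> {..<arity f} \<rightarrow> {..<k}" "xs \<in> tuples X k"
  shows "fn (twist (minor X k \<alpha> f) v) xs =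
    fn (twist f (\<lambda>i. v (\<alpha> i))) (map (\<lambda>i. xs ! \<alpha> i) [0..<arity f])"
proof -
  have 1: "map (\<lambda>i. xs ! \<alpha> i) [0..<arity f] \<in> tuples X (arity f)"
    using assms by (intro map_indices_in_tuples nth_in_tuples[OF assms(3)]) auto
  have 2: "map (\<lambda>j. v j (xs ! j)) [0..<k] \<in> tuples X k" by (rule twisted_arguments[OF assms(1,3)])
  have ar: "arity (minor X k \<alpha> f) = k" by (simp add: minor_def)
  have "map (\<lambda>i. map (\<lambda>j. v j (xs ! j)) [0..<k] ! \<alpha> i) [0..<arity f] =
      map (\<lambda>i. v (\<alpha> i) (map (\<lambda>i. xs ! \<alpha> i) [0..<arity f] ! i)) [0..<arity f]"
    using assms(2) by (auto simp: Pi_iff)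
  then show ?thesis
    using fn_twist[of xs "minor X k \<alpha> f" v] fn_twist[OF 1, of "\<lambda>i. v (\<alpha> i)"] assms(3) 2
    unfolding ar by (simp add: minor_def del: map_eq_conv)
qed

lemma minor_identity:
  assumes "f \<in> operations X"
  shows "minor X (arity f) (\<lambda>i. i) f = f"
proof (cases f)
  case (Operation n g)
  have "map ((!) xs) [0..<n] = xs" if "xs \<in> tuples X n" for xs
    using that map_nth[of xs] by (simp add: tuples_iff)
  then show ?thesis
    using assms by (auto simp: minor_def Operation operations_def PiE_def extensional_def restrict_def)
qed

end

locale ramsey_reduct = ramsey_structure A + reduct_structure A B
  for A :: "('s, 'a) struct" and B :: "('t, 'a) struct"
begin

text \<open>Colour a list of \<open>arity f\<close> tuples of the same length by the orbit of its image under \<open>f\<close>. The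
  product Ramsey property yields automorphisms after which \<open>f\<close> is canonical on a given finite set for
  tuples of bounded length; canonicity is inherited by a limit.\<close>
lemma canonization:
  assumes f: "f \<in> Pol B"
  shows "\<exists>g\<in>Pol B \<inter> Can A. interpolates X (Aut A) f g"
proof -
  define n where "n = arity f"
  have fX: "f \<in> operations X" by (rule Pol_operations[OF f])
  then have n: "n \<ge> 1" by (simp add: n_def operations_def)
  \<comment> \<open>The bounds on the tuples make the number of colours finite.\<close>
  define \<chi> where "\<chi> l ts = atomic_type
    (let ys = apply_componentwise f (length (hd ts)) ts in
      if set ys \<subseteq> X \<and> length ys \<le> l then ys else [])" for l and ts :: "'a list list"
  have \<chi>: "finite (range (\<chi> l))" for l
    by (rule finite_subset[OF _ finite_atomic_types[of l]]) (auto simp: \<chi>_def Let_def)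
  let ?Q = "\<lambda>l v. (\<forall>i<n. v i \<in> Aut A) \<and>
    (\<forall>ts ss. length ts = n \<and> length ss = n \<and>
        (\<forall>i<n. set (ts ! i) \<subseteq> segment l \<and> set (ss ! i) \<subseteq> segment l \<and> length (ts ! i) \<le> l \<and> ts ! i \<sim> ss ! i) \<longrightarrow>
      \<chi> l (map (\<lambda>i. map (v i) (ts ! i)) [0..<n]) = \<chi> l (map (\<lambda>i. map (v i) (ss ! i)) [0..<n]))"
  have "\<forall>l. \<exists>v. ?Q l v"
    by (intro allI ramsey_product finite_segment segment_subset \<chi>)
  then obtain v where Q: "\<forall>l. ?Q l (v l)" by (rule choice[THEN exE])
  have v: "v l i \<in> Aut A" if "i < n" for l i using Q that by simp
  note hom = Q[THEN spec, THEN conjunct2, THEN spec, THEN spec, THEN mp]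
  have canonical_on_segment:
    "apply_componentwise (twist f (v l)) r as \<sim> apply_componentwise (twist f (v l)) r bs"
    if as: "as \<in> tuples (tuples (segment l) r) n" and bs: "bs \<in> tuples (tuples (segment l) r) n"
      and o: "\<And>i. i < n \<Longrightarrow> as ! i \<sim> bs ! i" and r: "r \<le> l" for l r as bs
  proof -
    have colour: "\<chi> l (map (\<lambda>i. map (v l i) (cs ! i)) [0..<n]) =
        atomic_type (apply_componentwise (twist f (v l)) r cs)"
      and closed: "set (apply_componentwise (twist f (v l)) r cs) \<subseteq> X"
      if cs: "cs \<in> tuples (tuples (segment l) r) n" for cs
    proof -
      have cs': "cs \<in> tuples (tuples X r) (arity f)"
        using cs tuples_mono[OF tuples_mono[OF segment_subset]] unfolding n_def by blast
      have "hd (map (\<lambda>i. map (v l i) (cs ! i)) [0..<n]) = map (v l 0) (cs ! 0)"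
        using n by (simp add: hd_map upt_conv_Cons)
      then have hd: "length (hd (map (\<lambda>i. map (v l i) (cs ! i)) [0..<n])) = r"
        using nth_in_tuples[OF cs, of 0] n by (simp add: tuples_iff)
      have "twist f (v l) \<in> operations X"
        by (rule operations_twist[OF fX]) (use v n_def orbit_preserving_Aut in auto)
      then have mem: "apply_componentwise (twist f (v l)) r cs \<in> tuples X r"
        by (rule apply_componentwise_tuples) (use cs' in simp)
      then show "set (apply_componentwise (twist f (v l)) r cs) \<subseteq> X" by (simp add: tuples_iff)
      show "\<chi> l (map (\<lambda>i. map (v l i) (cs ! i)) [0..<n]) =
        atomic_type (apply_componentwise (twist f (v l)) r cs)"
        unfolding \<chi>_def hd using mem r apply_componentwise_twist[OF cs', of "v l"]
        by (simp add: tuples_iff n_def)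
    qed
    have mem: "as ! i \<in> tuples (segment l) r" "bs ! i \<in> tuples (segment l) r" if "i < n" for i
      using nth_in_tuples as bs that by blast+
    have "\<chi> l (map (\<lambda>i. map (v l i) (as ! i)) [0..<n]) = \<chi> l (map (\<lambda>i. map (v l i) (bs ! i)) [0..<n])"
      by (rule hom) (use as bs o r mem in \<open>auto simp: tuples_iff\<close>)
    then show ?thesis
      using colour[OF as] colour[OF bs] closed[OF as] closed[OF bs] same_orbit_iff_atomic_type by simp
  qed
  have tw: "twist f (v l) \<in> Pol B \<and> arity (twist f (v l)) = n" for l
    using Pol_twist[OF f] v orbit_preserving_Aut by (simp add: n_def)
  obtain g where g: "g \<in> Pol B" "arity g = n"
    and lim: "\<And>P. finite P \<and> P \<subseteq> tuples X n \<Longrightarrow>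
      infinite {l \<in> UNIV. conjugate_on P (fn (twist f (v l))) (fn g)}"
    using Pol_limit[of UNIV "\<lambda>l. twist f (v l)" n] tw by (auto simp del: Collect_const)
  have gX: "g \<in> operations X" using g(1) by (rule Pol_operations)
  have twX: "fn (twist f (v l)) xs \<in> X" if "xs \<in> tuples X n" for l xs
    using operations_closed[OF Pol_operations] tw that by metis
  have "interpolates X (Aut A) f g" unfolding interpolates_iff[OF fX]
  proof (intro conjI allI impI)
    show "arity f = arity g" using g(2) by (simp add: n_def)
    fix F assume F: "finite F \<and> F \<subseteq> X"
    have "infinite {l \<in> UNIV. conjugate_on (tuples F n) (fn (twist f (v l))) (fn g)}"
      using F by (intro lim) (auto simp: finite_tuples dest: tuples_mono)
    then obtain l where "conjugate_on (tuples F n) (fn (twist f (v l))) (fn g)"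
      using infinite_imp_nonempty by blast
    then show "\<exists>v. (\<forall>i<arity f. orbit_preserving (v i)) \<and>
        conjugate_on (tuples F (arity f)) (fn (twist f v)) (fn g)"
      using v orbit_preserving_Aut unfolding n_def[symmetric] by blast
  qed
  moreover have "g \<in> Can A"
  proof -
    have "apply_componentwise g r as \<sim> apply_componentwise g r bs"
      if as: "as \<in> tuples (tuples X r) n" and bs: "bs \<in> tuples (tuples X r) n"
        and o: "\<forall>i<n. as ! i \<sim> bs ! i" for r as bs
    proof -
      define P where "P = row as ` {..<r} \<union> row bs ` {..<r}"
      have P: "finite P" "P \<subseteq> tuples X n"
        using row_in_tuples[OF as] row_in_tuples[OF bs] by (auto simp: P_def)
      have "finite (\<Union> (set ` (set as \<union> set bs)))" "\<Union> (set ` (set as \<union> set bs)) \<subseteq> X"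
        using as bs by (auto simp: tuples_iff subset_iff)
      then obtain N where N: "\<Union> (set ` (set as \<union> set bs)) \<subseteq> segment N"
        using segments_exhaust by blast
      have "infinite {l \<in> UNIV. conjugate_on P (fn (twist f (v l))) (fn g)}" using P by (intro lim) simp
      then obtain l where l: "l \<ge> max N r" "conjugate_on P (fn (twist f (v l))) (fn g)"
        unfolding infinite_nat_iff_unbounded_le by blast
      have seg: "cs \<in> tuples (tuples (segment l) r) n"
        if "cs \<in> tuples (tuples X r) n" "set cs \<subseteq> set as \<union> set bs" for cs
        using that N segment_mono[of N l] l(1) unfolding tuples_iff subset_iff by auto
      have 1: "apply_componentwise (twist f (v l)) r as \<sim> apply_componentwise (twist f (v l)) r bs"
        by (rule canonical_on_segment) (use seg as bs o l(1) in auto)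
      have 2: "apply_componentwise (twist f (v l)) r as \<sim> apply_componentwise g r as"
        and 3: "apply_componentwise (twist f (v l)) r bs \<sim> apply_componentwise g r bs"
        by (rule apply_componentwise_conjugate[OF l(2)]; simp add: P_def)+
      have sX: "set (apply_componentwise (twist f (v l)) r as) \<subseteq> X"
        using twX row_in_tuples[OF as] by (auto simp: apply_componentwise_rows)
      show ?thesis
        using same_orbit_trans[OF same_orbit_sym[OF 2 sX] same_orbit_trans[OF 1 3 sX]]
          same_orbit_closed[OF 2 sX] by blast
    qed
    then show ?thesis using gX canonical_iff[OF gX] by (simp add: Can_def g(2))
  qed
  ultimately show ?thesis using g(1) by blast
qed

section \<open>Simultaneous interpolation\<close>

text \<open>As \<open>\<rho>\<close> and \<open>\<sigma>\<close> are independent, for each finite set and each argument position \<open>i\<close> there is one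
  automorphism \<open>e i\<close> that simultaneously acts like \<open>v (\<alpha> i)\<close> on the copy under \<open>\<rho>\<close> and like \<open>w i\<close> on the copy under
  \<open>\<sigma>\<close>. A limit \<open>m\<close> of the operations \<open>twist (f l) (e l)\<close> behaves like \<open>f l\<close> twisted by \<open>v\<close> on the first copy and like
  \<open>f l\<close> twisted by \<open>w\<close> on the second one. On the first copy the same maps are used for all positions that \<open>\<alpha>\<close>
  identifies, and therefore the minor of \<open>m\<close> interpolates \<open>h\<close>, always with \<open>\<rho>\<close> itself as the inner map.\<close>

lemma common_interpolation:
  fixes f :: "nat \<Rightarrow> 'a operation"
  assumes "independent \<rho> \<sigma>"
    and f: "\<And>l. f l \<in> Pol B" "\<And>l. arity (f l) = n" and \<alpha>: "\<alpha> \<in> {..<n} \<rightarrow> {..<k}"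
    and g: "arity g = n" "\<And>l. \<exists>w. (\<forall>i<n. orbit_preserving (w i)) \<and>
      conjugate_on (tuples (segment l) n) (fn (twist (f l) (\<lambda>i x. \<sigma> (w i x)))) (fn g)"
    and h: "arity h = k" "\<And>l. \<exists>v. (\<forall>j<k. orbit_preserving (v j)) \<and>
      conjugate_on (tuples (segment l) k) (fn (twist (minor X k \<alpha> (f l)) (\<lambda>j x. \<rho> (v j x)))) (fn h)"
  shows "\<exists>m\<in>Pol B. interpolates X (Aut A) m h \<and> interpolates X (Aut A) m (minor X k \<alpha> g)"
proof -
  have \<rho>: "orbit_preserving \<rho>" and \<sigma>: "orbit_preserving \<sigma>"
    and indep: "\<And>a b a' b'. set a \<subseteq> X \<Longrightarrow> set b \<subseteq> X \<Longrightarrow> a \<sim> a' \<Longrightarrow> b \<sim> b' \<Longrightarrow>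
       map \<rho> a @ map \<sigma> b \<sim> map \<rho> a' @ map \<sigma> b'"
    using \<open>independent \<rho> \<sigma>\<close> unfolding independent_def by auto
  have "\<forall>l. \<exists>w. (\<forall>i<n. orbit_preserving (w i)) \<and>
      conjugate_on (tuples (segment l) n) (fn (twist (f l) (\<lambda>i x. \<sigma> (w i x)))) (fn g)"
    using g(2) by blast
  then obtain w where "\<forall>l. (\<forall>i<n. orbit_preserving (w l i)) \<and>
      conjugate_on (tuples (segment l) n) (fn (twist (f l) (\<lambda>i x. \<sigma> (w l i x)))) (fn g)"
    by (rule choice[THEN exE])
  then have w: "\<And>l i. i < n \<Longrightarrow> orbit_preserving (w l i)"
      "\<And>l. conjugate_on (tuples (segment l) n) (fn (twist (f l) (\<lambda>i x. \<sigma> (w l i x)))) (fn g)"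
    by blast+
  have "\<forall>l. \<exists>v. (\<forall>j<k. orbit_preserving (v j)) \<and>
      conjugate_on (tuples (segment l) k) (fn (twist (minor X k \<alpha> (f l)) (\<lambda>j x. \<rho> (v j x)))) (fn h)"
    using h(2) by blast
  then obtain v where "\<forall>l. (\<forall>j<k. orbit_preserving (v l j)) \<and>
      conjugate_on (tuples (segment l) k) (fn (twist (minor X k \<alpha> (f l)) (\<lambda>j x. \<rho> (v l j x)))) (fn h)"
    by (rule choice[THEN exE])
  then have v: "\<And>l j. j < k \<Longrightarrow> orbit_preserving (v l j)"
      "\<And>l. conjugate_on (tuples (segment l) k) (fn (twist (minor X k \<alpha> (f l)) (\<lambda>j x. \<rho> (v l j x)))) (fn h)"
    by blast+
  have \<alpha>k: "\<alpha> i < k" if "i < n" for i using \<alpha> that by auto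
  define E where "E l i e \<longleftrightarrow> e \<in> Aut A \<and>
      (\<forall>x\<in>segment l. e (\<rho> x) = \<rho> (v l (\<alpha> i) x) \<and> e (\<sigma> x) = \<sigma> (w l i x))" for l i e
  have "\<exists>e. E l i e" if i: "i < n" for l i
  proof -
    obtain xs where xs: "set xs = segment l" using finite_segment finite_list by blast
    then have xsX: "set xs \<subseteq> X" using segment_subset by simp
    have "xs \<sim> map (v l (\<alpha> i)) xs" "xs \<sim> map (w l i) xs"
      using v(1)[OF \<alpha>k[OF i]] w(1)[OF i] xsX unfolding orbit_preserving_def by blast+
    then have "map \<rho> xs @ map \<sigma> xs \<sim> map \<rho> (map (v l (\<alpha> i)) xs) @ map \<sigma> (map (w l i) xs)"
      by (rule indep[OF xsX xsX])
    then show ?thesis unfolding same_orbit_def E_def by (auto simp: xs[symmetric])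
  qed
  then have "\<forall>l. \<forall>i. \<exists>e. i < n \<longrightarrow> E l i e" by blast
  then have "\<forall>l. \<exists>e. \<forall>i. i < n \<longrightarrow> E l i (e i)" by (intro allI choice) simp
  then obtain e where "\<forall>l. \<forall>i. i < n \<longrightarrow> E l i (e l i)" by (rule choice[THEN exE])
  then have e: "\<And>l i. i < n \<Longrightarrow> e l i \<in> Aut A"
    "\<And>l i x. i < n \<Longrightarrow> x \<in> segment l \<Longrightarrow> e l i (\<rho> x) = \<rho> (v l (\<alpha> i) x)"
    "\<And>l i x. i < n \<Longrightarrow> x \<in> segment l \<Longrightarrow> e l i (\<sigma> x) = \<sigma> (w l i x)"
    by (auto simp: E_def)
  have "twist (f l) (e l) \<in> Pol B \<and> arity (twist (f l) (e l)) = n" for l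
    using Pol_twist[OF f(1)] f(2) e(1) orbit_preserving_Aut by simp
  then obtain m where m: "m \<in> Pol B" "arity m = n"
    and lim: "\<And>P. finite P \<and> P \<subseteq> tuples X n \<Longrightarrow>
      infinite {l \<in> UNIV. conjugate_on P (fn (twist (f l) (e l))) (fn m)}"
    using Pol_limit[of UNIV "\<lambda>l. twist (f l) (e l)" n] by (auto simp del: Collect_const)
  have mX: "m \<in> operations X" using m(1) by (rule Pol_operations)
  define mm where "mm = minor X k \<alpha> m"
  have mm: "mm \<in> Pol B" "arity mm = k" using Pol_minor[OF m(1)] \<alpha> m(2) by (auto simp: mm_def minor_def)
  have mmX: "mm \<in> operations X" using mm(1) by (rule Pol_operations)
  \<comment> \<open>Here \<open>\<tau>\<close> stands for either of \<open>\<rho>\<close> and \<open>\<sigma>\<close>, and \<open>u\<close> for the maps that \<open>e l\<close> imitates on the copy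
    under \<open>\<tau>\<close>.\<close>
  have transfer: "conjugate_on (tuples F n) (fn (twist (f l) (\<lambda>i x. \<tau> (u i x)))) (fn (twist m (\<lambda>_. \<tau>)))"
    if \<tau>: "orbit_preserving \<tau>" and F: "F \<subseteq> segment l"
      and eu: "\<And>i x. i < n \<Longrightarrow> x \<in> segment l \<Longrightarrow> e l i (\<tau> x) = \<tau> (u i x)"
      and c: "conjugate_on ((\<lambda>xs. map (\<lambda>i. \<tau> (xs ! i)) [0..<n]) ` tuples F n)
        (fn (twist (f l) (e l))) (fn m)" for \<tau> u l F
  proof -
    have FX: "xs \<in> tuples X n" if "xs \<in> tuples F n" for xs
      using that tuples_mono[of F X n] F segment_subset by blast
    have args: "map (\<lambda>i. \<tau> (xs ! i)) [0..<n] \<in> tuples X n" if "xs \<in> tuples F n" for xs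
      using twisted_arguments[of n "\<lambda>_. \<tau>"] \<tau> FX[OF that] by blast
    have "conjugate_on (tuples F n) (\<lambda>xs. fn (twist (f l) (e l)) (map (\<lambda>i. \<tau> (xs ! i)) [0..<n]))
       (\<lambda>xs. fn m (map (\<lambda>i. \<tau> (xs ! i)) [0..<n]))"
      using c by (rule conjugate_on_reindex) simp
    then show ?thesis
    proof (rule conjugate_on_cong[THEN iffD1, rotated -1])
      fix xs assume xs: "xs \<in> tuples F n"
      have "map (\<lambda>i. e l i (map (\<lambda>i. \<tau> (xs ! i)) [0..<n] ! i)) [0..<n] = map (\<lambda>i. \<tau> (u i (xs ! i))) [0..<n]"
        using eu nth_in_tuples[OF xs] F by (simp add: subset_iff)
      then show "fn (twist (f l) (e l)) (map (\<lambda>i. \<tau> (xs ! i)) [0..<n]) =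
          fn (twist (f l) (\<lambda>i x. \<tau> (u i x))) xs"
        using fn_twist[of _ "f l"] args[OF xs] FX[OF xs] f(2) by (simp del: map_eq_conv)
      show "fn m (map (\<lambda>i. \<tau> (xs ! i)) [0..<n]) = fn (twist m (\<lambda>_. \<tau>)) xs"
        using fn_twist[of _ m] FX[OF xs] m(2) by simp
    qed
  qed
  have both: "\<exists>l. F \<subseteq> segment l \<and>
      conjugate_on (tuples F n) (fn (twist (f l) (\<lambda>i x. \<rho> (v l (\<alpha> i) x)))) (fn (twist m (\<lambda>_. \<rho>))) \<and>
      conjugate_on (tuples F n) (fn (twist (f l) (\<lambda>i x. \<sigma> (w l i x)))) (fn (twist m (\<lambda>_. \<sigma>)))"
    if F: "finite F" "F \<subseteq> X" for F
  proof -
    obtain N where N: "F \<subseteq> segment N" using segments_exhaust[OF F] by blast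
    let ?P = "\<lambda>\<tau>. (\<lambda>xs. map (\<lambda>i. \<tau> (xs ! i)) [0..<n]) ` tuples F n"
    have "?P \<tau> \<subseteq> tuples X n" if "orbit_preserving \<tau>" for \<tau>
      using twisted_arguments[of n "\<lambda>_. \<tau>"] that tuples_mono[OF F(2)] by blast
    then have "infinite {l \<in> UNIV. conjugate_on (?P \<rho> \<union> ?P \<sigma>) (fn (twist (f l) (e l))) (fn m)}"
      using \<rho> \<sigma> finite_tuples[OF F(1)] by (intro lim) auto
    then obtain l where l: "l \<ge> N" "conjugate_on (?P \<rho> \<union> ?P \<sigma>) (fn (twist (f l) (e l))) (fn m)"
      unfolding infinite_nat_iff_unbounded_le by blast
    have Fl: "F \<subseteq> segment l" using N segment_mono[OF l(1)] by blast
    have "conjugate_on (tuples F n) (fn (twist (f l) (\<lambda>i x. \<rho> (v l (\<alpha> i) x)))) (fn (twist m (\<lambda>_. \<rho>)))"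
      using l(2) by (intro transfer \<rho> Fl e(2)) (auto elim: conjugate_on_mono)
    moreover have "conjugate_on (tuples F n) (fn (twist (f l) (\<lambda>i x. \<sigma> (w l i x)))) (fn (twist m (\<lambda>_. \<sigma>)))"
      using l(2) by (intro transfer \<sigma> Fl e(3)) (auto elim: conjugate_on_mono)
    ultimately show ?thesis using Fl by blast
  qed
  have select: "map (\<lambda>i. xs ! \<alpha> i) [0..<n] \<in> tuples F n" if "xs \<in> tuples F k" for xs F
    using \<alpha>k by (intro map_indices_in_tuples nth_in_tuples[OF that])
  have twX: "fn (twist f' u) xs \<in> X"
    if "f' \<in> operations X" "\<And>i. i < arity f' \<Longrightarrow> orbit_preserving (u i)" "xs \<in> tuples X (arity f')" for f' u xs
    using operations_closed[OF operations_twist[OF that(1,2)]] that(3) by simp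
  have "interpolates X (Aut A) mm h" unfolding interpolates_iff[OF mmX] mm(2)
  proof (intro conjI allI impI exI[of _ "\<lambda>_. \<rho>"] \<rho>)
    show "k = arity h" by (simp add: h)
    fix F assume F: "finite F \<and> F \<subseteq> X"
    then obtain l where l: "F \<subseteq> segment l"
      "conjugate_on (tuples F n) (fn (twist (f l) (\<lambda>i x. \<rho> (v l (\<alpha> i) x)))) (fn (twist m (\<lambda>_. \<rho>)))"
      using both by blast
    have FX: "xs \<in> tuples X k" if "xs \<in> tuples F k" for xs
      using that tuples_mono[of F X k] F by blast
    have op: "orbit_preserving (\<lambda>x. \<rho> (v l j x))" if "j < k" for j
      by (rule orbit_preserving_comp[OF \<rho> v(1)[OF that]])
    have "conjugate_on (tuples F k)
        (\<lambda>xs. fn (twist (f l) (\<lambda>i x. \<rho> (v l (\<alpha> i) x))) (map (\<lambda>i. xs ! \<alpha> i) [0..<n]))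
        (\<lambda>xs. fn (twist m (\<lambda>_. \<rho>)) (map (\<lambda>i. xs ! \<alpha> i) [0..<n]))"
      using l(2) by (rule conjugate_on_reindex) (use select in blast)
    then have 1: "conjugate_on (tuples F k) (fn (twist (minor X k \<alpha> (f l)) (\<lambda>j x. \<rho> (v l j x)))) (fn (twist mm (\<lambda>_. \<rho>)))"
    proof (rule conjugate_on_cong[THEN iffD1, rotated -1])
      fix xs assume xs: "xs \<in> tuples F k"
      show "fn (twist (f l) (\<lambda>i x. \<rho> (v l (\<alpha> i) x))) (map (\<lambda>i. xs ! \<alpha> i) [0..<n]) =
          fn (twist (minor X k \<alpha> (f l)) (\<lambda>j x. \<rho> (v l j x))) xs"
        using fn_twist_minor[of k "\<lambda>j x. \<rho> (v l j x)" \<alpha> "f l" xs] op \<alpha> FX[OF xs] f(2) by simp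
      show "fn (twist m (\<lambda>_. \<rho>)) (map (\<lambda>i. xs ! \<alpha> i) [0..<n]) = fn (twist mm (\<lambda>_. \<rho>)) xs"
        using fn_twist_minor[of k "\<lambda>_. \<rho>" \<alpha> m xs] \<rho> \<alpha> FX[OF xs] m(2) by (simp add: mm_def)
    qed
    have 2: "conjugate_on (tuples F k) (fn (twist (minor X k \<alpha> (f l)) (\<lambda>j x. \<rho> (v l j x)))) (fn h)"
      using v(2) by (rule conjugate_on_mono) (rule tuples_mono[OF l(1)])
    have "minor X k \<alpha> (f l) \<in> operations X"
      by (rule operations_minor[OF Pol_operations[OF f(1)]]) (simp add: f(2) \<alpha>)
    then have im: "fn (twist (minor X k \<alpha> (f l)) (\<lambda>j x. \<rho> (v l j x))) ` tuples F k \<subseteq> X"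
      using twX[of "minor X k \<alpha> (f l)" "\<lambda>j x. \<rho> (v l j x)"] op FX by (auto simp: minor_def)
    show "conjugate_on (tuples F k) (fn (twist mm (\<lambda>_. \<rho>))) (fn h)"
    proof (rule conjugate_on_trans[OF conjugate_on_sym[OF 1 im] 2])
      show "fn (twist mm (\<lambda>_. \<rho>)) ` tuples F k \<subseteq> X" using twX[OF mmX, of "\<lambda>_. \<rho>"] \<rho> FX mm(2) by auto
    qed
  qed
  moreover have "interpolates X (Aut A) mm (minor X k \<alpha> g)" unfolding interpolates_iff[OF mmX] mm(2)
  proof (intro conjI allI impI exI[of _ "\<lambda>_. \<sigma>"] \<sigma>)
    show "k = arity (minor X k \<alpha> g)" by (simp add: minor_def)
    fix F assume F: "finite F \<and> F \<subseteq> X"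
    then obtain l where l: "F \<subseteq> segment l"
      "conjugate_on (tuples F n) (fn (twist (f l) (\<lambda>i x. \<sigma> (w l i x)))) (fn (twist m (\<lambda>_. \<sigma>)))"
      using both by blast
    have FX: "xs \<in> tuples X k" if "xs \<in> tuples F k" for xs k
      using that tuples_mono[of F X k] F by blast
    have op: "orbit_preserving (\<lambda>x. \<sigma> (w l i x))" if "i < n" for i
      by (rule orbit_preserving_comp[OF \<sigma> w(1)[OF that]])
    have 2: "conjugate_on (tuples F n) (fn (twist (f l) (\<lambda>i x. \<sigma> (w l i x)))) (fn g)"
      using w(2) by (rule conjugate_on_mono) (rule tuples_mono[OF l(1)])
    have im: "fn (twist (f l) (\<lambda>i x. \<sigma> (w l i x))) ` tuples F n \<subseteq> X"
      using twX[OF Pol_operations[OF f(1)], of l "\<lambda>i x. \<sigma> (w l i x)"] op FX f(2) by auto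
    have im': "fn (twist m (\<lambda>_. \<sigma>)) ` tuples F n \<subseteq> X"
      using twX[OF mX, of "\<lambda>_. \<sigma>"] \<sigma> FX m(2) by auto
    have "conjugate_on (tuples F n) (fn (twist m (\<lambda>_. \<sigma>))) (fn g)"
      by (rule conjugate_on_trans[OF conjugate_on_sym[OF l(2) im] 2 im'])
    then have "conjugate_on (tuples F k) (\<lambda>xs. fn (twist m (\<lambda>_. \<sigma>)) (map (\<lambda>i. xs ! \<alpha> i) [0..<n]))
        (\<lambda>xs. fn g (map (\<lambda>i. xs ! \<alpha> i) [0..<n]))"
      by (rule conjugate_on_reindex) (use select in blast)
    then show "conjugate_on (tuples F k) (fn (twist mm (\<lambda>_. \<sigma>))) (fn (minor X k \<alpha> g))"
    proof (rule conjugate_on_cong[THEN iffD1, rotated -1])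
      fix xs assume xs: "xs \<in> tuples F k"
      show "fn (twist m (\<lambda>_. \<sigma>)) (map (\<lambda>i. xs ! \<alpha> i) [0..<n]) = fn (twist mm (\<lambda>_. \<sigma>)) xs"
        using fn_twist_minor[of k "\<lambda>_. \<sigma>" \<alpha> m xs] \<sigma> \<alpha> FX[OF xs] m(2) by (simp add: mm_def)
      show "fn g (map (\<lambda>i. xs ! \<alpha> i) [0..<n]) = fn (minor X k \<alpha> g) xs"
        using FX[OF xs] g(1) by (simp add: minor_def)
    qed
  qed
  ultimately show ?thesis using mm(1) by blast
qed

end

section \<open>The extension\<close>

locale uip_map = ramsey_reduct A B
  for A :: "('s, 'a) struct" and B :: "('t, 'a) struct" +
  fixes Y :: "'c set" and E :: "'c operation set" and \<zeta> :: "'a operation \<Rightarrow> 'c operation"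
  assumes minor_preserving: "minor_preserving X (Pol B \<inter> Can A) Y E \<zeta>"
    and UIP: "has_UIP A (Pol B) (Pol B \<inter> Can A) \<zeta>"
begin

definition extension :: "'a operation \<Rightarrow> 'c operation" where
  "extension f = \<zeta> (SOME g. g \<in> Pol B \<inter> Can A \<and> interpolates X (Aut A) f g)"

lemma UIP_D:
  "f \<in> Pol B \<Longrightarrow> g \<in> Pol B \<inter> Can A \<Longrightarrow> h \<in> Pol B \<inter> Can A \<Longrightarrow>
    interpolates X (Aut A) f g \<Longrightarrow> interpolates X (Aut A) f h \<Longrightarrow> \<zeta> g = \<zeta> h"
  using UIP unfolding has_UIP_def by blast

lemma extension_eq:
  assumes "f \<in> Pol B" "g \<in> Pol B \<inter> Can A" "interpolates X (Aut A) f g"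
  shows "extension f = \<zeta> g"
proof -
  have "(SOME g. g \<in> Pol B \<inter> Can A \<and> interpolates X (Aut A) f g) \<in> Pol B \<inter> Can A \<and>
      interpolates X (Aut A) f (SOME g. g \<in> Pol B \<inter> Can A \<and> interpolates X (Aut A) f g)"
    using assms(2,3) by (intro someI[of "\<lambda>g. g \<in> Pol B \<inter> Can A \<and> interpolates X (Aut A) f g" g]) simp
  then show ?thesis unfolding extension_def using UIP_D assms by blast
qed

lemma extension_extends: "f \<in> Pol B \<inter> Can A \<Longrightarrow> extension f = \<zeta> f"
  using extension_eq[of f f] interpolates_refl Pol_operations by blast

text \<open>The canonical operation that determines the image of \<open>f\<close> can be found inside any copy of the
  structure.\<close>
lemma twisted_canonization:
  assumes f: "f \<in> Pol B" and \<tau>: "orbit_preserving \<tau>"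
  shows "\<exists>g\<in>Pol B \<inter> Can A. arity g = arity f \<and> extension f = \<zeta> g \<and>
    (\<forall>l. \<exists>v. (\<forall>i<arity f. orbit_preserving (v i)) \<and>
      conjugate_on (tuples (segment l) (arity f)) (fn (twist f (\<lambda>i x. \<tau> (v i x)))) (fn g))"
proof -
  have tw: "twist f (\<lambda>_. \<tau>) \<in> Pol B" by (rule Pol_twist[OF f \<tau>])
  obtain g where g: "g \<in> Pol B \<inter> Can A" "interpolates X (Aut A) (twist f (\<lambda>_. \<tau>)) g"
    using canonization[OF tw] by blast
  have *: "arity f = arity g \<and> (\<forall>F. finite F \<and> F \<subseteq> X \<longrightarrow>
      (\<exists>v. (\<forall>i<arity f. orbit_preserving (v i)) \<and>
        conjugate_on (tuples F (arity f)) (fn (twist (twist f (\<lambda>_. \<tau>)) v)) (fn g)))"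
    using g(2) unfolding interpolates_iff[OF Pol_operations[OF tw]] arity_twist .
  note ar = *[THEN conjunct1]
  note int = *[THEN conjunct2, THEN spec, THEN mp, OF conjI[OF finite_segment segment_subset]]
  have "\<exists>v. (\<forall>i<arity f. orbit_preserving (v i)) \<and>
      conjugate_on (tuples (segment l) (arity f)) (fn (twist f (\<lambda>i x. \<tau> (v i x)))) (fn g)" for l
  proof -
    from int[of l] obtain v where v: "\<forall>i<arity f. orbit_preserving (v i)"
      "conjugate_on (tuples (segment l) (arity f)) (fn (twist (twist f (\<lambda>_. \<tau>)) v)) (fn g)"
      by (elim exE conjE)
    moreover have "twist (twist f (\<lambda>_. \<tau>)) v = twist f (\<lambda>i x. \<tau> (v i x))"
      by (rule twist_twist) (use v(1) in blast)
    ultimately show ?thesis by auto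
  qed
  moreover have "interpolates X (Aut A) f g"
    by (rule interpolates_twistD[OF Pol_operations[OF f] _ g(2)]) (rule \<tau>)
  ultimately show ?thesis using g(1) ar extension_eq[OF f g(1)] by auto
qed

text \<open>With \<open>g\<close> canonical for \<open>f\<close> inside the second copy and \<open>h\<close> canonical for the minor of \<open>f\<close> inside the
  first copy, some polymorphism interpolates both \<open>h\<close> and the minor of \<open>g\<close>.\<close>
lemma extension_minor:
  assumes f: "f \<in> Pol B" and \<alpha>: "\<alpha> \<in> {..<arity f} \<rightarrow> {..<k}"
  shows "extension (minor X k \<alpha> f) = minor Y k \<alpha> (extension f)"
proof -
  obtain \<rho> \<sigma> where indep: "independent \<rho> \<sigma>"
    using independent_copies by blast
  then have \<rho>: "orbit_preserving \<rho>" and \<sigma>: "orbit_preserving \<sigma>"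
    by (simp_all add: independent_def)
  have fm: "minor X k \<alpha> f \<in> Pol B" "arity (minor X k \<alpha> f) = k"
    using Pol_minor[OF f \<alpha>] by (simp_all add: minor_def)
  obtain g where g: "g \<in> Pol B \<inter> Can A" "arity g = arity f" "extension f = \<zeta> g"
    "\<And>l. \<exists>v. (\<forall>i<arity f. orbit_preserving (v i)) \<and>
      conjugate_on (tuples (segment l) (arity f)) (fn (twist f (\<lambda>i x. \<sigma> (v i x)))) (fn g)"
    using twisted_canonization[OF f \<sigma>] by blast
  obtain h where h: "h \<in> Pol B \<inter> Can A" "arity h = k" "extension (minor X k \<alpha> f) = \<zeta> h"
    "\<And>l. \<exists>v. (\<forall>i<k. orbit_preserving (v i)) \<and>
      conjugate_on (tuples (segment l) k) (fn (twist (minor X k \<alpha> f) (\<lambda>i x. \<rho> (v i x)))) (fn h)"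
    using twisted_canonization[OF fm(1) \<rho>] unfolding fm(2) by blast
  have "\<exists>m\<in>Pol B. interpolates X (Aut A) m h \<and> interpolates X (Aut A) m (minor X k \<alpha> g)"
    by (rule common_interpolation[OF indep f refl \<alpha> g(2,4) h(2,4)])
  then obtain m where m: "m \<in> Pol B" "interpolates X (Aut A) m h"
    "interpolates X (Aut A) m (minor X k \<alpha> g)"
    by blast
  have "minor X k \<alpha> g \<in> Pol B \<inter> Can A"
    using Pol_minor[of g \<alpha> k] Can_minor[of g \<alpha> k] g(1,2) \<alpha> by simp
  then have "\<zeta> h = \<zeta> (minor X k \<alpha> g)" using UIP_D m h(1) by blast
  also have "\<dots> = minor Y k \<alpha> (\<zeta> g)"
    using minor_preserving g(1,2) \<alpha> unfolding minor_preserving_def by simp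
  finally show ?thesis using g(3) h(3) by simp
qed

lemma minor_preserving_extension: "minor_preserving X (Pol B) Y E extension"
proof -
  have "extension f \<in> E \<and> arity (extension f) = arity f" if f: "f \<in> Pol B" for f
  proof -
    obtain g where g: "g \<in> Pol B \<inter> Can A" "interpolates X (Aut A) f g"
      using canonization[OF f] by blast
    then have "arity f = arity g" by (simp add: interpolates_def)
    then show ?thesis
      using extension_eq[OF f g] minor_preserving g(1) unfolding minor_preserving_def by auto
  qed
  then show ?thesis unfolding minor_preserving_def using extension_minor by blast
qed

text \<open>Otherwise there are \<open>f l\<close> and \<open>g l\<close> that agree on \<open>segment l\<close> and have different images. The
  common limit \<open>p\<close> of the two sequences provides an operation \<open>e\<close> that links the images.\<close>
lemma extension_determined_on_finite_set:
  "\<exists>F. finite F \<and> F \<subseteq> X \<and> (\<forall>f\<in>Pol B. \<forall>g\<in>Pol B. arity f = m \<and> arity g = m \<and>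
     (\<forall>xs\<in>tuples F m. fn f xs = fn g xs) \<longrightarrow> extension f = extension g)"
proof (rule ccontr)
  assume no: "\<not> ?thesis"
  obtain \<rho> \<sigma> where indep: "independent \<rho> \<sigma>"
    using independent_copies by blast
  then have \<rho>: "orbit_preserving \<rho>" and \<sigma>: "orbit_preserving \<sigma>"
    by (simp_all add: independent_def)
  have "\<exists>f g. f \<in> Pol B \<and> g \<in> Pol B \<and> arity f = m \<and> arity g = m \<and>
     (\<forall>xs\<in>tuples (segment l) m. fn f xs = fn g xs) \<and> extension f \<noteq> extension g" for l
    using no finite_segment[of l] segment_subset[of l] by blast
  then obtain f g :: "nat \<Rightarrow> 'a operation" where f: "\<And>l. f l \<in> Pol B" "\<And>l. arity (f l) = m"
    and g: "\<And>l. g l \<in> Pol B" "\<And>l. arity (g l) = m"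
    and fg: "\<And>l xs. xs \<in> tuples (segment l) m \<Longrightarrow> fn (f l) xs = fn (g l) xs"
    and ne: "\<And>l. extension (f l) \<noteq> extension (g l)"
    by metis
  define canonizes where "canonizes \<tau> f c \<longleftrightarrow> c \<in> Pol B \<inter> Can A \<and> arity c = m \<and> extension f = \<zeta> c \<and>
    (\<forall>l. \<exists>v. (\<forall>i<m. orbit_preserving (v i)) \<and>
      conjugate_on (tuples (segment l) m) (fn (twist f (\<lambda>i x. \<tau> (v i x)))) (fn c))" for \<tau> f c
  have ex: "\<exists>c. canonizes \<tau> f c" if "f \<in> Pol B" "arity f = m" "orbit_preserving \<tau>" for \<tau> f
    using twisted_canonization[OF that(1,3)] unfolding canonizes_def that(2) by blast
  obtain c d where c: "\<And>l. canonizes \<sigma> (f l) (c l)" and d: "\<And>l. canonizes \<sigma> (g l) (d l)"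
    using ex[OF f \<sigma>] ex[OF g \<sigma>] by metis
  have cP: "c l \<in> Pol B \<inter> Can A" "arity (c l) = m" "extension (f l) = \<zeta> (c l)"
    and dP: "d l \<in> Pol B \<inter> Can A" "arity (d l) = m" "extension (g l) = \<zeta> (d l)" for l
    using c[of l] d[of l] by (auto simp: canonizes_def)
  obtain S where S: "finite S" "S \<subseteq> X" and determined: "\<And>c d F. c \<in> Can A \<Longrightarrow> d \<in> Can A \<Longrightarrow>
      arity c = m \<Longrightarrow> arity d = m \<Longrightarrow> conjugate_on (tuples S m) (fn c) (fn d) \<Longrightarrow>
      finite F \<Longrightarrow> F \<subseteq> X \<Longrightarrow> conjugate_on (tuples F m) (fn c) (fn d)"
    using canonical_determined_on_finite_set[of m] by auto
  obtain ps where ps: "set ps = tuples S m" using finite_list[OF finite_tuples[OF S(1)]] by blast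
  define t where "t l = map (fn (c l)) ps @ map (fn (d l)) ps" for l
  have val: "fn f xs \<in> X" if "f \<in> Pol B" "arity f = m" "xs \<in> tuples X m" for f xs
    using operations_closed[OF Pol_operations] that by blast
  have cdX: "fn (c l) xs \<in> X" "fn (d l) xs \<in> X" if "xs \<in> tuples X m" for l xs
    using val[of "c l"] val[of "d l"] cP dP that by auto
  have "set (t l) \<subseteq> X \<and> length (t l) \<le> length ps + length ps" for l
    using cdX ps tuples_mono[OF S(2), of m] by (auto simp: t_def subset_iff)
  then obtain l0 where inf: "infinite {l \<in> UNIV. t l0 \<sim> t l}"
    using orbit_pigeonhole[of UNIV t "length ps + length ps"] by auto
  \<comment> \<open>From here on only indices are used for which the canonical operations behave like those for
    \<open>l0\<close>.\<close>
  define K where "K = {l. t l0 \<sim> t l}"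
  have K: "infinite K" using inf by (simp add: K_def)
  have same: "conjugate_on (tuples F m) (fn (c l)) (fn (c l0))" "conjugate_on (tuples F m) (fn (d l)) (fn (d l0))"
    if l: "l \<in> K" and F: "finite F" "F \<subseteq> X" for l F
  proof -
    have "map (fn (c l0)) ps \<sim> map (fn (c l)) ps" "map (fn (d l0)) ps \<sim> map (fn (d l)) ps"
      using l by (auto simp: K_def t_def same_orbit_def)
    then have "conjugate_on (tuples S m) (fn (c l0)) (fn (c l))" "conjugate_on (tuples S m) (fn (d l0)) (fn (d l))"
      by (simp_all add: conjugate_on_set[symmetric] ps)
    then have "conjugate_on (tuples F m) (fn (c l0)) (fn (c l))" "conjugate_on (tuples F m) (fn (d l0)) (fn (d l))"
      using determined cP dP F by auto
    moreover have "fn (c l0) ` tuples F m \<subseteq> X" "fn (d l0) ` tuples F m \<subseteq> X"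
      using cdX tuples_mono[OF F(2), of m] by (auto simp: subset_iff)
    ultimately show "conjugate_on (tuples F m) (fn (c l)) (fn (c l0))" "conjugate_on (tuples F m) (fn (d l)) (fn (d l0))"
      using conjugate_on_sym by auto
  qed
  obtain p where p: "p \<in> Pol B" "arity p = m"
    and lim: "\<And>P. finite P \<and> P \<subseteq> tuples X m \<Longrightarrow> infinite {l \<in> K. conjugate_on P (fn (f l)) (fn p)}"
    using Pol_limit[of K f m] f K by auto
  obtain e where e: "canonizes \<rho> p e" using ex[OF p \<rho>] by blast
  then have eP: "e \<in> Pol B \<inter> Can A" "arity e = m" by (auto simp: canonizes_def)
  define R where "R j q \<longleftrightarrow> (\<exists>v. (\<forall>i<m. orbit_preserving (v i)) \<and>
      conjugate_on (tuples (segment j) m) (fn (twist q (\<lambda>i x. \<rho> (v i x)))) (fn e))" for j q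
  have "\<exists>l\<in>K. R j (f l) \<and> R j (g l)" for j
  proof -
    obtain v where v: "\<And>i. i < m \<Longrightarrow> orbit_preserving (v i)"
      and ve: "conjugate_on (tuples (segment j) m) (fn (twist p (\<lambda>i x. \<rho> (v i x)))) (fn e)"
      using e unfolding canonizes_def by blast
    define w where "w i x = \<rho> (v i x)" for i x
    have w: "orbit_preserving (w i)" if "i < m" for i
      unfolding w_def by (rule orbit_preserving_comp[OF \<rho> v[OF that]])
    define args where "args xs = map (\<lambda>i. w i (xs ! i)) [0..<m]" for xs
    have segX: "xs \<in> tuples X m" if "xs \<in> tuples (segment j) m" for xs
      using that tuples_mono[OF segment_subset] by blast
    have argsX: "args xs \<in> tuples X m" if "xs \<in> tuples (segment j) m" for xs
      unfolding args_def using w segX[OF that] by (rule twisted_arguments)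
    have P: "finite (args ` tuples (segment j) m)" "args ` tuples (segment j) m \<subseteq> tuples X m"
      using finite_tuples[OF finite_segment] argsX by auto
    have "finite (\<Union> (set ` args ` tuples (segment j) m))" using P(1) by blast
    moreover have "\<Union> (set ` args ` tuples (segment j) m) \<subseteq> X"
      using argsX unfolding tuples_def by blast
    ultimately obtain N where N: "\<Union> (set ` args ` tuples (segment j) m) \<subseteq> segment N"
      using segments_exhaust by blast
    have "infinite {l \<in> K. conjugate_on (args ` tuples (segment j) m) (fn (f l)) (fn p)}"
      by (intro lim conjI P)
    then obtain l where l: "l \<ge> N" "l \<in> K" "conjugate_on (args ` tuples (segment j) m) (fn (f l)) (fn p)"
      unfolding infinite_nat_iff_unbounded_le by blast
    have tw: "fn (twist q w) xs = fn q (args xs)" if "arity q = m" "xs \<in> tuples (segment j) m" for q xs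
      using fn_twist[of xs q w] that segX by (simp add: args_def)
    \<comment> \<open>Since \<open>l\<close> is large, \<open>segment l\<close> contains all values that witness the interpolation of \<open>e\<close>; there \<open>f l\<close> and
      \<open>g l\<close> agree.\<close>
    have agree: "fn (g l) (args xs) = fn (f l) (args xs)" if "xs \<in> tuples (segment j) m" for xs
    proof (rule fg[symmetric])
      have "set (args xs) \<subseteq> segment l" using N that segment_mono[OF l(1)] by blast
      then show "args xs \<in> tuples (segment l) m" using argsX[OF that] by (simp add: tuples_iff)
    qed
    have "conjugate_on (tuples (segment j) m) (\<lambda>xs. fn (f l) (args xs)) (\<lambda>xs. fn p (args xs))"
      using l(3) by (rule conjugate_on_reindex) simp
    moreover have "conjugate_on (tuples (segment j) m) (\<lambda>xs. fn p (args xs)) (fn e)"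
      using ve unfolding w_def[symmetric]
      by (rule conjugate_on_cong[THEN iffD1, rotated -1]) (use tw[OF p(2)] in auto)
    ultimately have *: "conjugate_on (tuples (segment j) m) (\<lambda>xs. fn (f l) (args xs)) (fn e)"
      by (rule conjugate_on_trans) (use val[OF f] argsX in auto)
    then have "conjugate_on (tuples (segment j) m) (fn (twist (f l) w)) (fn e)"
      by (rule conjugate_on_cong[THEN iffD1, rotated -1]) (use tw[OF f(2)] in auto)
    moreover from * have "conjugate_on (tuples (segment j) m) (fn (twist (g l) w)) (fn e)"
      by (rule conjugate_on_cong[THEN iffD1, rotated -1]) (use tw[OF g(2)] agree in auto)
    ultimately have "R j (f l)" "R j (g l)" using v unfolding R_def w_def by blast+
    then show ?thesis using l(2) by blast
  qed
  then obtain \<kappa> where \<kappa>: "\<And>j. \<kappa> j \<in> K" "\<And>j. R j (f (\<kappa> j))" "\<And>j. R j (g (\<kappa> j))" by metis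
  have id: "(\<lambda>i. i) \<in> {..<m} \<rightarrow> {..<m}" by simp
  have key: "\<zeta> e = \<zeta> c0"
    if q: "\<And>j. q j \<in> Pol B" "\<And>j. arity (q j) = m" and R: "\<And>j. R j (q j)"
      and can: "\<And>j. canonizes \<sigma> (q j) (cs j)" and c0: "c0 \<in> Pol B \<inter> Can A" "arity c0 = m"
      and c0s: "\<And>j. conjugate_on (tuples (segment j) m) (fn (cs j)) (fn c0)"
    for q :: "nat \<Rightarrow> 'a operation" and cs c0
  proof -
    have 1: "\<exists>w. (\<forall>i<m. orbit_preserving (w i)) \<and>
      conjugate_on (tuples (segment j) m) (fn (twist (q j) (\<lambda>i x. \<sigma> (w i x)))) (fn c0)" for j
    proof -
      obtain w where w: "\<forall>i<m. orbit_preserving (w i)"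
        "conjugate_on (tuples (segment j) m) (fn (twist (q j) (\<lambda>i x. \<sigma> (w i x)))) (fn (cs j))"
        using can[of j] unfolding canonizes_def by blast
      have "twist (q j) (\<lambda>i x. \<sigma> (w i x)) \<in> Pol B"
        by (rule Pol_twist[OF q(1)]) (use w(1) q(2) orbit_preserving_comp[OF \<sigma>] in auto)
      then have "fn (twist (q j) (\<lambda>i x. \<sigma> (w i x))) ` tuples (segment j) m \<subseteq> X"
        using val q(2) tuples_mono[OF segment_subset, of j m] by (auto simp: subset_iff)
      then show ?thesis using w(1) conjugate_on_trans[OF w(2) c0s] by blast
    qed
    have 2: "\<exists>v. (\<forall>i<m. orbit_preserving (v i)) \<and>
      conjugate_on (tuples (segment j) m) (fn (twist (minor X m (\<lambda>i. i) (q j)) (\<lambda>i x. \<rho> (v i x)))) (fn e)" for j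
      using R[of j] minor_identity[OF Pol_operations[OF q(1)], of j] unfolding R_def q(2) by simp
    have "\<exists>r\<in>Pol B. interpolates X (Aut A) r e \<and> interpolates X (Aut A) r (minor X m (\<lambda>i. i) c0)"
      by (rule common_interpolation[OF indep q id c0(2) 1 eP(2) 2])
    then obtain r where r: "r \<in> Pol B" "interpolates X (Aut A) r e"
      "interpolates X (Aut A) r (minor X m (\<lambda>i. i) c0)"
      by blast
    have "minor X m (\<lambda>i. i) c0 = c0"
      using minor_identity[OF Pol_operations] c0 by auto
    then show ?thesis using UIP_D[OF r(1) eP(1) c0(1)] r(2,3) by simp
  qed
  have "\<zeta> e = \<zeta> (c l0)"
    by (rule key[of "\<lambda>j. f (\<kappa> j)" "\<lambda>j. c (\<kappa> j)"])
      (use f \<kappa> c cP same finite_segment segment_subset in auto)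
  moreover have "\<zeta> e = \<zeta> (d l0)"
    by (rule key[of "\<lambda>j. g (\<kappa> j)" "\<lambda>j. d (\<kappa> j)"])
      (use g \<kappa> d dP same finite_segment segment_subset in auto)
  ultimately show False using ne[of l0] cP(3) dP(3) by simp
qed

text \<open>The values of an operation on tuples over a set \<open>G\<close> of size \<open>m\<close> are values of its \<open>m\<close>-ary minors on one
  fixed enumeration of \<open>G\<close>, so a single finite set works for operations of all arities.\<close>
lemma uniformly_continuous_extension: "clone_uniformly_continuous X (Pol B) Y extension"
  unfolding clone_uniformly_continuous_def
proof (intro allI impI)
  fix G assume G: "finite G \<and> G \<subseteq> Y"
  then obtain ys where ys: "set ys = G" using finite_list by blast
  define m where "m = length ys"
  obtain F where F: "finite F" "F \<subseteq> X" and det: "\<forall>f\<in>Pol B. \<forall>g\<in>Pol B. arity f = m \<and> arity g = m \<and>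
     (\<forall>xs\<in>tuples F m. fn f xs = fn g xs) \<longrightarrow> extension f = extension g"
    using extension_determined_on_finite_set[of m] by (elim exE conjE)
  have agree: "fn (extension f) zs = fn (extension g) zs"
    if f: "f \<in> Pol B" "arity f = n" and g: "g \<in> Pol B" "arity g = n"
      and eq: "\<forall>xs\<in>tuples F n. fn f xs = fn g xs" and zs: "zs \<in> tuples G n" for f g n zs
  proof -
    have "\<exists>j<m. ys ! j = zs ! i" if "i < n" for i
      using nth_in_tuples[OF zs that] ys by (auto simp: in_set_conv_nth m_def)
    then obtain \<alpha> where \<alpha>: "\<And>i. i < n \<Longrightarrow> \<alpha> i < m \<and> ys ! \<alpha> i = zs ! i" by metis
    then have \<alpha>': "\<alpha> \<in> {..<n} \<rightarrow> {..<m}" by auto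
    have zs_eq: "map (\<lambda>i. ys ! \<alpha> i) [0..<n] = zs"
      using \<alpha> zs by (intro nth_equalityI) (auto simp: tuples_iff)
    have "extension (minor X m \<alpha> f) = extension (minor X m \<alpha> g)"
    proof (rule det[rule_format])
      show "minor X m \<alpha> f \<in> Pol B" "minor X m \<alpha> g \<in> Pol B"
        using Pol_minor f g \<alpha>' by auto
      have "fn (minor X m \<alpha> f) xs = fn (minor X m \<alpha> g) xs" if xs: "xs \<in> tuples F m" for xs
      proof -
        have "map (\<lambda>i. xs ! \<alpha> i) [0..<n] \<in> tuples F n"
          using \<alpha> by (intro map_indices_in_tuples nth_in_tuples[OF xs]) auto
        then show ?thesis using eq f(2) g(2) by (simp add: minor_def)
      qed
      then show "arity (minor X m \<alpha> f) = m \<and> arity (minor X m \<alpha> g) = m \<and>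
          (\<forall>xs\<in>tuples F m. fn (minor X m \<alpha> f) xs = fn (minor X m \<alpha> g) xs)"
        by (simp add: minor_def)
    qed
    then have "minor Y m \<alpha> (extension f) = minor Y m \<alpha> (extension g)"
      using extension_minor f g \<alpha>' by simp
    moreover have "arity (extension f) = n" "arity (extension g) = n"
      using minor_preserving_extension f g unfolding minor_preserving_def by auto
    moreover have "ys \<in> tuples Y m" using ys G by (simp add: tuples_iff m_def)
    ultimately show ?thesis
      using zs_eq unfolding minor_def by (metis (no_types, lifting) operation.inject restrict_apply')
  qed
  show "\<exists>F. finite F \<and> F \<subseteq> X \<and>
      (\<forall>n. \<forall>f\<in>Pol B. \<forall>g\<in>Pol B. arity f = n \<and> arity g = n \<and> (\<forall>xs\<in>tuples F n. fn f xs = fn g xs) \<longrightarrow>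
        (\<forall>xs\<in>tuples G n. fn (extension f) xs = fn (extension g) xs))"
    by (intro exI[of _ F] conjI allI ballI impI F) (rule agree; simp)
qed

end

theorem lemma6p1:
  fixes A :: "('s, 'a) struct" and B :: "('t, 'a) struct"
    and Y :: "'c set" and E :: "'c operation set"
    and \<zeta> :: "'a operation \<Rightarrow> 'c operation"
  assumes "is_structure A" and "countable (univ A)" and "finitely_homogeneous A" and "ramsey A"
    and "reduct B A"
    and "clone Y E"
    and "minor_preserving (univ A) (Pol B \<inter> Can A) Y E \<zeta>"
    and "has_UIP A (Pol B) (Pol B \<inter> Can A) \<zeta>"
  shows "\<exists>\<zeta>'. (\<forall>f\<in>Pol B \<inter> Can A. \<zeta>' f = \<zeta> f) \<and>
           minor_preserving (univ A) (Pol B) Y E \<zeta>' \<and>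
           clone_uniformly_continuous (univ A) (Pol B) Y \<zeta>'"
proof -
  interpret uip_map A B Y E \<zeta>
    using assms by unfold_locales
  show ?thesis
    using extension_extends minor_preserving_extension uniformly_continuous_extension by blast
qed

end
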